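(* Let $m,n,r$ be integers with $n \ge m > r \ge 0$. Then, as $H\to\infty$, \[ \#\mathcal{L}_{m,n,r}(\mathbb{Q};H) \le \begin{cases} H^{2mr+nr+n-r^2-r+o(1)}, & \text{if } 2m \ge n+r,\\ H^{2nr+2m-2r+o(1)}, & \text{if } 2m < n+r.\end{cases} \]
   Context: For a real $H\ge 1$, let $\mathcal{F}(H)=\{a/b:\ a,b\in\mathbb{Z},\ 0\le |a|,b\le H,\ \gcd(a,b)=1\}$ be the set of rationals in lowest terms of naive height at most $H$. Let $\mathcal{M}_{m,n}(\mathbb{Q};H)$ be the set of $m\times n$ matrices all of whose entries lie in $\mathcal{F}(H)$, and let $\mathcal{L}_{m,n,r}(\mathbb{Q};H)=\{A\in\mathcal{M}_{m,n}(\mathbb{Q};H):\ \operatorname{rank}A=r\}$. Here $m,n,r$ are fixed and $H\to\infty$; a bound $X\le H^{c+o(1)}$ means that for every $\varepsilon>0$ one has $X\le H^{c+\varepsilon}$ for all sufficiently large $H$ (depending on $\varepsilon,m,n,r$). *)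

theory Defs
  imports Complex_Main "Jordan_Normal_Form.DL_Rank"
begin

text \<open>The numerator and denominator range over integers, the height \<open>H\<close> is real. The
  denominator is required to be positive: a zero denominator does not give a rational number
  (whereas in HOL it would give \<open>x / 0 = 0\<close>).\<close>

definition height_rats :: "real \<Rightarrow> rat set" where
  "height_rats H = {of_int a / of_int b | a b :: int.
     b > 0 \<and> \<bar>real_of_int a\<bar> \<le> H \<and> real_of_int b \<le> H \<and> coprime a b}"

definition height_mats :: "nat \<Rightarrow> nat \<Rightarrow> real \<Rightarrow> rat mat set" where
  "height_mats m n H = {A \<in> carrier_mat m n. \<forall>i<m. \<forall>j<n. A $$ (i, j) \<in> height_rats H}"

text \<open>The parameter of the locale \<^locale>\<open>vec_space\<close> is the length of the
  columns, so \<open>vec_space.rank m\<close> is the column rank of a matrix with \<open>m\<close> rows.\<close>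

definition height_mats_rank :: "nat \<Rightarrow> nat \<Rightarrow> nat \<Rightarrow> real \<Rightarrow> rat mat set" where
  "height_mats_rank m n r H = {A \<in> height_mats m n H. vec_space.rank m A = r}"

text \<open>\<open>X(H) \<le> H\<^bsup>c+o(1)\<^esup>\<close> as \<open>H \<rightarrow> \<infinity>\<close>.\<close>

definition powr_o1_bound :: "(real \<Rightarrow> real) \<Rightarrow> real \<Rightarrow> bool" where
  "powr_o1_bound X c \<longleftrightarrow>
     (\<forall>\<epsilon>>0. eventually (\<lambda>H. X H \<le> H powr (c + \<epsilon>)) at_top)"

text \<open>The sets counted are finite, so that \<^const>\<open>card\<close> is the actual number of elements.\<close>

lemma finite_height_rats: "finite (height_rats H)"
proof (rule finite_subset)
  let ?I = "{- \<lfloor>H\<rfloor>..\<lfloor>H\<rfloor>}"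
  show "height_rats H \<subseteq> (\<lambda>(a, b). of_int a / of_int b) ` (?I \<times> ?I)"
  proof
    fix x assume "x \<in> height_rats H"
    then obtain a b :: int where x: "x = of_int a / of_int b" and b: "b > 0"
      and le: "\<bar>real_of_int a\<bar> \<le> H" "real_of_int b \<le> H"
      unfolding height_rats_def by blast
    have "\<bar>a\<bar> \<le> \<lfloor>H\<rfloor>" "b \<le> \<lfloor>H\<rfloor>"
      using le by (simp_all add: le_floor_iff)
    then have "(a, b) \<in> ?I \<times> ?I" using b by auto
    then show "x \<in> (\<lambda>(a, b). of_int a / of_int b) ` (?I \<times> ?I)"
      using x by force
  qed
qed simp

lemma finite_height_mats: "finite (height_mats m n H)"
proof (rule finite_subset)
  let ?P = "({..<m} \<times> {..<n}) \<rightarrow>\<^sub>E height_rats H"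
  show "height_mats m n H \<subseteq> mat m n ` ?P"
  proof
    fix A assume A: "A \<in> height_mats m n H"
    let ?f = "restrict (\<lambda>ij. A $$ ij) ({..<m} \<times> {..<n})"
    have "A = mat m n ?f"
      using A by (intro eq_matI) (auto simp: height_mats_def)
    moreover have "?f \<in> ?P"
      using A by (auto simp: height_mats_def)
    ultimately show "A \<in> mat m n ` ?P" by blast
  qed
  show "finite (mat m n ` ?P)"
    by (intro finite_imageI finite_PiE) (auto simp: finite_height_rats)
qed

lemma finite_height_mats_rank: "finite (height_mats_rank m n r H)"
  by (rule finite_subset[OF _ finite_height_mats[of m n H]]) (auto simp: height_mats_rank_def)

end

theory Submission
  imports Defs "HOL-Analysis.Analysis" "HOL-Real_Asymp.Real_Asymp"
begin

text \<open>A rank \<open>r\<close> matrix is determined by \<open>r\<close> columns spanning its column space, together with the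
  remaining columns, which lie in that span. The span satisfies relations expressing each coordinate
  through \<open>r\<close> fixed ones; let \<open>t\<close> be the largest number of nonzero coefficients in such a relation.
  If \<open>t\<close> is small there are few choices for the \<open>r\<close> spanning columns: at most
  \<open>H\<^bsup>2r\<^sup>2 + 2t(m - r)\<^esup>\<close> up to constants. If \<open>t\<close> is large there are few choices for each of the other
  columns: a linear equation with \<open>k\<close> nonzero coefficients has at most \<open>H\<^bsup>k + o(1)\<^esup>\<close> solutions in
  \<open>F(H)\<^sup>k\<close>, uniformly in the coefficients, so (for \<open>t \<ge> 1\<close>) each column has
  \<open>H\<^bsup>2r - t + 1 + o(1)\<^esup>\<close> choices. The total exponent is linear in \<open>t\<close>, and its values at \<open>t = r\<close> and
  \<open>t = 1\<close> are the two exponents of the theorem.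

  The bound for a linear equation is obtained by detecting it with additive characters modulo an
  integer \<open>M\<close> coprime to the coefficients. For each frequency the sum over numerators is large only for
  the denominators dividing an integer near a fixed one, so the product of the character sums is
  controlled by moments of the divisor function.\<close>

section \<open>Coordinate relations\<close>

text \<open>Elimination: one vector of the family serves as pivot and is removed from all the
  others, which costs one coordinate. The result is applied to columns as well as to rows.\<close>

lemma coordinate_dependence:
  fixes v :: "'s \<Rightarrow> 'i \<Rightarrow> 'a::field"
  assumes "finite S"
  shows "\<exists>K c. finite K \<and> K \<subseteq> I \<and> card K \<le> card S \<and>
    (\<forall>s\<in>S. \<forall>i\<in>I. v s i = (\<Sum>l\<in>K. c i l * v s l))"
  using assms
proof (induction S arbitrary: v rule: finite_induct)
  case empty
  show ?case by (intro exI[of _ "{}"]) auto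
next
  case (insert s0 S)
  show ?case
  proof (cases "\<forall>i\<in>I. v s0 i = 0")
    case True
    from insert.IH[of v] obtain K c where K: "finite K" "K \<subseteq> I" "card K \<le> card S"
      "\<forall>s\<in>S. \<forall>i\<in>I. v s i = (\<Sum>l\<in>K. c i l * v s l)" by blast
    moreover have "(\<Sum>l\<in>K. c i l * v s0 l) = 0" for i
      using True K(2) by (intro sum.neutral) auto
    ultimately show ?thesis using True insert.hyps
      by (intro exI[of _ K] exI[of _ c]) auto
  next
    case False
    then obtain j where j: "j \<in> I" "v s0 j \<noteq> 0" by blast
    \<comment> \<open>\<open>u\<close> is the pivot vector scaled to the value 1 at
      \<open>j\<close>, so subtracting \<open>v s j * u\<close> makes every vector vanish at
      \<open>j\<close>.\<close>
    define u where "u i = v s0 i / v s0 j" for i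
    have u: "v s0 i = v s0 j * u i" for i using j by (simp add: u_def)
    from insert.IH[of "\<lambda>s i. v s i - v s j * u i"] obtain K c
      where K: "finite K" "K \<subseteq> I" "card K \<le> card S"
        and c: "\<And>s i. s \<in> S \<Longrightarrow> i \<in> I \<Longrightarrow>
          v s i - v s j * u i = (\<Sum>l\<in>K. c i l * (v s l - v s j * u l))" by blast
    \<comment> \<open>The reduced vectors vanish at \<open>j\<close>, so \<open>j\<close> may leave
      \<open>K\<close>. Undoing the reduction brings \<open>j\<close> back, with what the
      combination of the \<open>u l\<close> leaves of \<open>u i\<close> as its coefficient.\<close>
    define L where "L = K - {j}"
    define c' where "c' i l = (if l = j then u i - (\<Sum>l\<in>L. c i l * u l) else c i l)" for i l
    have finL: "finite L" "j \<notin> L" using K by (auto simp: L_def)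
    have exp: "(\<Sum>l\<in>insert j L. c' i l * v s l)
        = (u i - (\<Sum>l\<in>L. c i l * u l)) * v s j + (\<Sum>l\<in>L. c i l * v s l)" for s i
    proof -
      have "(\<Sum>l\<in>L. c' i l * v s l) = (\<Sum>l\<in>L. c i l * v s l)"
        using finL by (intro sum.cong) (auto simp: c'_def)
      then show ?thesis using finL by (simp add: c'_def)
    qed
    have "v s i = (\<Sum>l\<in>insert j L. c' i l * v s l)" if s: "s \<in> insert s0 S" and i: "i \<in> I" for s i
    proof (cases "s = s0")
      case True
      have "(\<Sum>l\<in>L. c i l * v s0 l) = (\<Sum>l\<in>L. c i l * u l) * v s0 j"
        by (subst u) (simp add: sum_distrib_left sum_distrib_right mult_ac)
      then show ?thesis unfolding exp True using u[of i] by (simp add: algebra_simps)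
    next
      case False
      then have "s \<in> S" using s by simp
      have uj: "u j = 1" using j by (simp add: u_def)
      have "v s i - v s j * u i = (\<Sum>l\<in>K. c i l * (v s l - v s j * u l))"
        by (rule c[OF \<open>s \<in> S\<close> i])
      also have "\<dots> = (\<Sum>l\<in>L. c i l * (v s l - v s j * u l))"
        unfolding L_def using K uj by (intro sum.mono_neutral_right) auto
      also have "\<dots> = (\<Sum>l\<in>L. c i l * v s l) - v s j * (\<Sum>l\<in>L. c i l * u l)"
        by (simp add: algebra_simps sum_subtractf sum_distrib_left)
      finally show ?thesis unfolding exp by (simp add: algebra_simps)
    qed
    moreover have "card L \<le> card S"
      using K card_mono[of K L] by (simp add: L_def)
    then have "card (insert j L) \<le> card (insert s0 S)"
      using insert.hyps finL by simp
    ultimately show ?thesis using K j finL unfolding L_def[symmetric]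
      by (intro exI[of _ "insert j L"] exI[of _ c']) (auto simp: L_def)
  qed
qed

text \<open>Padding with zero coefficients makes the size exact, so that later the set of free rows
  has exactly \<open>r\<close> elements.\<close>

lemma coordinate_dependence_card_eq:
  fixes v :: "'s \<Rightarrow> 'i \<Rightarrow> 'a::field"
  assumes "finite S" "finite I" "card S \<le> card I"
  shows "\<exists>K c. K \<subseteq> I \<and> card K = card S \<and>
    (\<forall>s\<in>S. \<forall>i\<in>I. v s i = (\<Sum>l\<in>K. c i l * v s l))"
proof -
  obtain K c where K: "finite K" "K \<subseteq> I" "card K \<le> card S"
    "\<And>s i. s \<in> S \<Longrightarrow> i \<in> I \<Longrightarrow> v s i = (\<Sum>l\<in>K. c i l * v s l)"
    using coordinate_dependence[OF assms(1), of I v] by blast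
  obtain L where L: "K \<subseteq> L" "L \<subseteq> I" "card L = card S"
    using exists_subset_between[OF K(3) assms(3) K(2) assms(2)] by blast
  have "v s i = (\<Sum>l\<in>L. (if l \<in> K then c i l else 0) * v s l)" if "s \<in> S" "i \<in> I" for s i
  proof -
    have "(\<Sum>l\<in>L. (if l \<in> K then c i l else 0) * v s l) = (\<Sum>l\<in>K. c i l * v s l)"
      using L assms(2) finite_subset by (intro sum.mono_neutral_cong_right) auto
    then show ?thesis using K(4)[OF that] by simp
  qed
  then show ?thesis using L by (intro exI[of _ L] exI[of _ "\<lambda>i l. if l \<in> K then c i l else 0"]) auto
qed

text \<open>Every vector in the span inherits the coordinate relations of the spanning vectors, so
  its entries on at most \<open>card S\<close> coordinates determine it.\<close>

lemma card_grid_points_span_le: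
  fixes v :: "'s \<Rightarrow> 'i \<Rightarrow> 'a::field"
  assumes "finite S" "finite I" "finite F" "F \<noteq> {}"
  shows "card {w \<in> I \<rightarrow>\<^sub>E F. \<exists>d. \<forall>i\<in>I. w i = (\<Sum>s\<in>S. d s * v s i)} \<le> card F ^ card S"
proof -
  let ?W = "{w \<in> I \<rightarrow>\<^sub>E F. \<exists>d. \<forall>i\<in>I. w i = (\<Sum>s\<in>S. d s * v s i)}"
  obtain K c where K: "finite K" "K \<subseteq> I" "card K \<le> card S"
    "\<And>s i. s \<in> S \<Longrightarrow> i \<in> I \<Longrightarrow> v s i = (\<Sum>l\<in>K. c i l * v s l)"
    using coordinate_dependence[OF assms(1), of I v] by blast
  have dep: "w i = (\<Sum>l\<in>K. c i l * w l)" if w: "w \<in> ?W" and i: "i \<in> I" for w i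
  proof -
    obtain d where d: "\<And>i. i \<in> I \<Longrightarrow> w i = (\<Sum>s\<in>S. d s * v s i)" using w by blast
    have "w i = (\<Sum>s\<in>S. d s * (\<Sum>l\<in>K. c i l * v s l))" using d[OF i] K(4) i by simp
    also have "\<dots> = (\<Sum>l\<in>K. \<Sum>s\<in>S. d s * (c i l * v s l))"
      by (subst sum.swap) (simp add: sum_distrib_left)
    also have "\<dots> = (\<Sum>l\<in>K. c i l * w l)"
      using K(2) d by (intro sum.cong refl) (auto simp: sum_distrib_left mult_ac)
    finally show ?thesis .
  qed
  have "inj_on (\<lambda>w. restrict w K) ?W"
  proof (rule inj_onI)
    fix w w' assume w: "w \<in> ?W" "w' \<in> ?W" and eq: "restrict w K = restrict w' K"
    have "w l = w' l" if "l \<in> K" for l using fun_cong[OF eq, of l] that by simp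
    then have "w i = w' i" if "i \<in> I" for i using dep[OF w(1) that] dep[OF w(2) that] by simp
    then show "w = w'" using w by (intro PiE_ext[of w I "\<lambda>_. F" w']) auto
  qed
  moreover have "(\<lambda>w. restrict w K) ` ?W \<subseteq> K \<rightarrow>\<^sub>E F" using K(2) by auto
  ultimately have "card ?W \<le> card (K \<rightarrow>\<^sub>E F)"
    using K assms by (intro card_inj_on_le finite_PiE) auto
  also have "\<dots> = card F ^ card K" using K by (simp add: card_PiE)
  also have "\<dots> \<le> card F ^ card S"
    using K(3) assms by (intro power_increasing) (auto simp: Suc_le_eq card_gt_0_iff)
  finally show ?thesis .
qed

text \<open>A maximal independent set of columns has \<open>rank A\<close> elements and spans all
  columns. A set of columns forgets positions, so one position \<open>g v\<close> is chosen for each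
  of its members.\<close>

lemma (in vec_space) columns_spanned_by_rank_columns:
  assumes A: "A \<in> carrier_mat n nc"
  shows "\<exists>J\<subseteq>{..<nc}. card J = rank A \<and>
    (\<forall>j<nc. \<exists>d. \<forall>i<n. A $$ (i, j) = (\<Sum>q\<in>J. d q * A $$ (i, q)))"
proof -
  let ?P = "\<lambda>T. T \<subseteq> set (cols A) \<and> lin_indpt T"
  have carr: "set (cols A) \<subseteq> carrier_vec n" using cols_dim A by blast
  have "lin_indpt {}" using finite_lin_indpt2[of "{}"] by auto
  then obtain S where S: "finite S" "maximal S ?P"
    using maximal_exists_superset[of "set (cols A)" ?P "{}"] by auto
  then have Sc: "S \<subseteq> set (cols A)" "lin_indpt S" by (auto simp: maximal_def)
  have Scarr: "S \<subseteq> carrier_vec n" using Sc carr by blast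
  have rk: "rank A = card S" using rank_card_indpt[OF A S(2)] .
  have span: "v \<in> span S" if v: "v \<in> set (cols A)" for v
  proof (rule ccontr)
    assume nv: "v \<notin> span S"
    have "S \<subseteq> span S" using Scarr by (rule in_own_span)
    then have "v \<notin> S" using nv by blast
    then have "lin_indpt (S \<union> {v})"
      using lin_dep_iff_in_span[OF Scarr Sc(2)] nv v carr by blast
    then have "S \<union> {v} = S" using S(2) Sc(1) v unfolding maximal_def by blast
    then show False using \<open>v \<notin> S\<close> by blast
  qed
  have "\<forall>v\<in>S. \<exists>q<nc. v = col A q"
    using Sc(1) A by (fastforce simp: cols_def)
  then obtain g where g: "\<And>v. v \<in> S \<Longrightarrow> g v < nc \<and> v = col A (g v)" by metis
  have inj: "inj_on g S" using g by (metis inj_onI)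
  have "\<exists>d. \<forall>i<n. A $$ (i, j) = (\<Sum>q\<in>g ` S. d q * A $$ (i, q))" if j: "j < nc" for j
  proof -
    have "col A j \<in> set (cols A)" using j A by (auto simp: cols_def)
    then have "col A j \<in> span S" by (rule span)
    then obtain a where a: "col A j = lincomb a S" using finite_span[OF S(1) Scarr] by auto
    have "A $$ (i, j) = (\<Sum>q\<in>g ` S. a (col A q) * A $$ (i, q))" if i: "i < n" for i
    proof -
      have "A $$ (i, j) = lincomb a S $ i" using i j A by (simp flip: a)
      also have "\<dots> = (\<Sum>v\<in>S. a v * v $ i)" by (rule lincomb_index[OF i Scarr])
      also have "\<dots> = (\<Sum>v\<in>S. a (col A (g v)) * A $$ (i, g v))"
      proof (rule sum.cong[OF refl])
        fix v assume v: "v \<in> S"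
        have gv: "g v < nc" "col A (g v) = v" using g[OF v] by simp_all
        have "col A (g v) $ i = A $$ (i, g v)" using gv(1) i A by (intro index_col) auto
        then show "a v * v $ i = a (col A (g v)) * A $$ (i, g v)" by (simp only: gv(2))
      qed
      also have "\<dots> = (\<Sum>q\<in>g ` S. a (col A q) * A $$ (i, q))"
        using inj by (simp add: sum.reindex)
      finally show ?thesis .
    qed
    then show ?thesis by (intro exI[of _ "\<lambda>q. a (col A q)"]) auto
  qed
  moreover have "g ` S \<subseteq> {..<nc}" using g by auto
  moreover have "card (g ` S) = rank A" using inj rk by (simp add: card_image)
  ultimately show ?thesis by (intro exI[of _ "g ` S"]) auto
qed

section \<open>The divisor function\<close>

text \<open>A prime power \<open>p ^ a\<close> has \<open>a + 1\<close> divisors; the constant is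
  what a small prime costs in the divisor bound. The estimate comes from
  \<open>1 + x \<le> exp x\<close>.\<close>

lemma Suc_le_const_mult_powr:
  fixes e :: real
  assumes "e > 0"
  shows "real (Suc a) \<le> (1 + 1 / (e * ln 2)) * 2 powr (e * real a)"
proof -
  have "1 + e * real a * ln 2 \<le> exp (e * real a * ln 2)"
    by (rule exp_ge_add_one_self)
  also have "\<dots> = 2 powr (e * real a)"
    by (simp add: powr_def)
  finally have *: "1 + e * real a * ln 2 \<le> 2 powr (e * real a)" .
  have "real (Suc a) \<le> (1 + 1 / (e * ln 2)) * (1 + e * real a * ln 2)"
    using assms by (simp add: field_simps)
  also have "\<dots> \<le> (1 + 1 / (e * ln 2)) * 2 powr (e * real a)"
    using * assms by (intro mult_left_mono) auto
  finally show ?thesis .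
qed

lemma card_divisors_prime_power_mult:
  fixes p m :: nat
  assumes "prime p" "m > 0"
  shows "card {d. d dvd p ^ a * m} \<le> Suc a * card {d. d dvd m}"
proof -
  have "{d. d dvd p ^ a * m} \<subseteq> (\<lambda>(i, d). p ^ i * d) ` ({..a} \<times> {d. d dvd m})"
  proof
    fix d assume "d \<in> {d. d dvd p ^ a * m}"
    then obtain x y where "d = x * y" "x dvd p ^ a" "y dvd m"
      using division_decomp by blast
    moreover from \<open>x dvd p ^ a\<close> obtain i where "i \<le> a" "x = p ^ i"
      using \<open>prime p\<close> divides_primepow_nat by blast
    ultimately show "d \<in> (\<lambda>(i, d). p ^ i * d) ` ({..a} \<times> {d. d dvd m})" by force
  qed
  then have "card {d. d dvd p ^ a * m} \<le> card ({..a} \<times> {d. d dvd m})"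
    using assms by (intro surj_card_le) auto
  then show ?thesis by (simp add: card_cartesian_product)
qed

text \<open>A prime \<open>p \<ge> 2 powr (1 / e)\<close> satisfies
  \<open>p powr (e * a) \<ge> 2 ^ a \<ge> a + 1\<close> and costs no constant. Each smaller prime
  costs a factor \<open>K\<close>, and there are at most \<open>P\<close> of them.\<close>

lemma divisor_bound:
  fixes e :: real
  assumes "e > 0"
  shows "\<exists>C\<ge>1. \<forall>n>0. real (card {d::nat. d dvd n}) \<le> C * real n powr e"
proof -
  define K where "K = 1 + 1 / (e * ln 2)"
  define P where "P = nat \<lceil>2 powr (1 / e)\<rceil>"
  define S where "S = (\<lambda>n::nat. {p. prime p \<and> p dvd n \<and> p < P})"
  have K: "K \<ge> 1" using assms by (simp add: K_def)
  have finS: "finite (S n)" for n by (rule finite_subset[of _ "{..<P}"]) (auto simp: S_def)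
  \<comment> \<open>The exponent of \<open>K\<close> counts the small primes dividing
    \<open>n\<close>. The induction splits off one full prime power at a time and pays
    \<open>K\<close> only when its prime is small.\<close>
  have main: "real (card {d::nat. d dvd n}) \<le> K ^ card (S n) * real n powr e" if "n > 0" for n
    using that
  proof (induction n rule: less_induct)
    case (less n)
    show ?case
    proof (cases "n = 1")
      case True
      then show ?thesis using K by simp
    next
      case False
      then obtain p where p: "prime p" "p dvd n" using prime_factor_nat by blast
      define a where "a = multiplicity p n"
      obtain m where m: "n = p ^ a * m" "\<not> p dvd m"
        using multiplicity_decompose'[of n p] less.prems not_prime_unit[of p] p(1)
        unfolding a_def by blast
      have m0: "m > 0" using m less.prems by (metis dvd_0_right not_gr_zero)
      have a0: "a > 0" using p m by (metis gr0I power_0 mult_1)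
      have "m < n"
      proof -
        have "1 < p ^ a" using prime_gt_1_nat[OF p(1)] a0 by (rule one_less_power)
        then show ?thesis using m m0 by simp
      qed
      have step: "real (Suc a) * K ^ card (S m) \<le> K ^ card (S n) * (real p powr (e * real a))"
      proof (cases "p < P")
        case True
        have "insert p (S m) \<subseteq> S n" using True p m by (auto simp: S_def)
        moreover have "p \<notin> S m" using m by (auto simp: S_def)
        ultimately have "Suc (card (S m)) \<le> card (S n)"
          using finS by (metis card_insert_disjoint card_mono)
        then have "K ^ Suc (card (S m)) \<le> K ^ card (S n)" using K by (rule power_increasing)
        moreover have "real (Suc a) \<le> K * real p powr (e * real a)"
        proof -
          have "real (Suc a) \<le> K * 2 powr (e * real a)"
            unfolding K_def by (rule Suc_le_const_mult_powr[OF assms])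
          also have "\<dots> \<le> K * real p powr (e * real a)"
            using K prime_ge_2_nat[OF p(1)] assms by (intro mult_left_mono powr_mono2) auto
          finally show ?thesis .
        qed
        ultimately have "real (Suc a) * K ^ card (S m) \<le> (K * real p powr (e * real a)) * K ^ card (S m)"
          using K by (intro mult_right_mono) auto
        also have "\<dots> = K ^ Suc (card (S m)) * real p powr (e * real a)" by simp
        also have "\<dots> \<le> K ^ card (S n) * (real p powr (e * real a))"
          using \<open>K ^ Suc (card (S m)) \<le> K ^ card (S n)\<close> by (intro mult_right_mono) auto
        finally show ?thesis .
      next
        case False
        have "card (S m) \<le> card (S n)"
          using m by (intro card_mono finS) (auto simp: S_def)
        then have *: "K ^ card (S m) \<le> K ^ card (S n)" using K by (rule power_increasing)
        have "2 powr (1 / e) \<le> real p" using False unfolding P_def by linarith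
        then have "(2 powr (1 / e)) powr e \<le> real p powr e"
          using assms by (intro powr_mono2) auto
        then have "2 \<le> real p powr e" using assms by (simp add: powr_powr)
        then have "2 ^ a \<le> (real p powr e) ^ a" by (intro power_mono) auto
        also have "\<dots> = real p powr (e * real a)"
          using p(1) by (simp add: powr_power mult.commute)
        finally have "2 ^ a \<le> real p powr (e * real a)" .
        moreover have "real (Suc a) \<le> 2 ^ a"
          using less_exp[of a] by (metis Suc_leI of_nat_le_iff of_nat_numeral of_nat_power)
        ultimately have "real (Suc a) \<le> real p powr (e * real a)" by linarith
        then have "real (Suc a) * K ^ card (S m) \<le> real p powr (e * real a) * K ^ card (S n)"
          using * K by (intro mult_mono) auto
        then show ?thesis by (simp add: mult.commute)
      qed
      have "real (card {d. d dvd n}) \<le> real (Suc a) * real (card {d. d dvd m})"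
        unfolding m(1) using card_divisors_prime_power_mult[OF p(1) m0, of a]
        by (metis of_nat_le_iff of_nat_mult)
      also have "\<dots> \<le> real (Suc a) * (K ^ card (S m) * real m powr e)"
        using less.IH[OF \<open>m < n\<close> m0] by (intro mult_left_mono) auto
      also have "\<dots> \<le> (K ^ card (S n) * (real p powr (e * real a))) * real m powr e"
        using mult_right_mono[OF step, of "real m powr e"] by (simp add: mult.assoc)
      also have "\<dots> = K ^ card (S n) * real n powr e"
        using p(1) m0 by (simp add: m(1) powr_mult powr_realpow[symmetric] powr_powr prime_gt_0_nat mult.commute)
      finally show ?thesis .
    qed
  qed
  have "real (card {d::nat. d dvd n}) \<le> K ^ P * real n powr e" if "n > 0" for n
  proof -
    have "card (S n) \<le> card {..<P}" by (intro card_mono) (auto simp: S_def)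
    then have "K ^ card (S n) \<le> K ^ P" using K by (intro power_increasing) auto
    then show ?thesis using main[OF that] mult_right_mono[of _ _ "real n powr e"]
      by (meson order_trans powr_ge_zero)
  qed
  moreover have "K ^ P \<ge> 1" using K by simp
  ultimately show ?thesis by blast
qed

text \<open>The harmonic sum is at most \<open>1 + ln N\<close>, and
  \<open>e * ln N \<le> N powr e\<close>.\<close>

lemma harm_le_powr:
  fixes e :: real
  assumes "e > 0" "N \<ge> 1"
  shows "(\<Sum>l\<in>{1..N}. 1 / real l) \<le> (1 + 1 / e) * real N powr e"
proof -
  obtain j where j: "N = Suc j" using assms(2) by (cases N) auto
  have "(\<Sum>l\<in>{1..N}. 1 / real l) = harm N"
    by (simp add: harm_def inverse_eq_divide)
  also have "harm N - ln (real N) \<le> harm (Suc 0) - ln (real (Suc 0))"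
    using decseqD[OF decseq_harm_diff_ln, of 0 j] j by simp
  then have "harm N \<le> 1 + ln (real N)" by (simp add: harm_expand)
  also have "e * ln (real N) \<le> real N powr e"
  proof -
    have "real N powr e > 0" using assms(2) by simp
    then have "ln (real N powr e) \<le> real N powr e - 1" by (rule ln_le_minus_one)
    then show ?thesis using assms(2) by (simp add: ln_powr)
  qed
  then have "ln (real N) \<le> (1 / e) * real N powr e"
    using assms(1) by (simp add: field_simps)
  moreover have "1 \<le> real N powr e"
    using assms by (intro ge_one_powr_ge_zero) auto
  ultimately show ?thesis by (simp add: distrib_right)
qed

section \<open>Moments of the number of small divisors\<close>

lemma card_multiples_le:
  fixes L D :: nat
  assumes "L > 0"
  shows "real (card {n\<in>{1..D}. L dvd n}) \<le> real D / real L"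
proof -
  have "{n\<in>{1..D}. L dvd n} \<subseteq> (*) L ` {1..D div L}"
    using assms by (auto simp: image_iff less_eq_div_iff_mult_less_eq mult.commute Bex_def elim!: dvdE)
  then have "card {n\<in>{1..D}. L dvd n} \<le> card {1..D div L}"
    by (intro surj_card_le) auto
  then have "real (card {n\<in>{1..D}. L dvd n}) \<le> real (D div L)" by simp
  also have "\<dots> \<le> real D / real L" by (rule of_nat_div_le_of_nat)
  finally show ?thesis .
qed

text \<open>The left side counts \<open>k\<close>-tuples of divisors of \<open>n\<close> up to
  \<open>N\<close>. The least common multiple \<open>L\<close> of such a tuple divides
  \<open>n\<close>, is at most \<open>N ^ k\<close>, and is divisible by every entry.\<close>

lemma card_small_divisors_power_le:
  fixes n N :: nat
  assumes "n > 0"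
  shows "card {b\<in>{1..N}. b dvd n} ^ k \<le> (\<Sum>L\<in>{L\<in>{1..N^k}. L dvd n}. card {d. d dvd L} ^ k)"
proof -
  let ?A = "{b\<in>{1..N}. b dvd n}"
  let ?T = "{L\<in>{1..N^k}. L dvd n}"
  let ?P = "\<lambda>A. {..<k} \<rightarrow>\<^sub>E A"
  have "?P ?A \<subseteq> (\<Union>L\<in>?T. ?P {d. d dvd L})"
  proof
    fix f assume f: "f \<in> ?P ?A"
    define L where "L = Lcm (f ` {..<k})"
    have "L dvd n" unfolding L_def using f by (intro Lcm_least) auto
    moreover have "L > 0" using \<open>L dvd n\<close> assms by (metis dvd_0_left_iff not_gr_zero)
    moreover have "L \<le> N ^ k"
    proof -
      have "L dvd prod f {..<k}" unfolding L_def by (intro Lcm_least) auto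
      moreover have "prod f {..<k} > 0" using PiE_mem[OF f] by (intro prod_pos) fastforce
      ultimately have "L \<le> prod f {..<k}" by (rule dvd_imp_le)
      also have "\<dots> \<le> (\<Prod>i<k. N)" using f by (intro prod_mono) auto
      finally show ?thesis by simp
    qed
    moreover have "f \<in> ?P {d. d dvd L}"
      using f by (auto simp: L_def PiE_iff)
    ultimately show "f \<in> (\<Union>L\<in>?T. ?P {d. d dvd L})" by (intro UN_I[of L]) auto
  qed
  then have "card (?P ?A) \<le> card (\<Union>L\<in>?T. ?P {d. d dvd L})"
    by (intro card_mono finite_UN_I finite_PiE) auto
  also have "\<dots> \<le> (\<Sum>L\<in>?T. card (?P {d. d dvd L}))"
    by (rule card_UN_le) auto
  finally show ?thesis by (simp add: card_PiE)
qed

text \<open>The divisor bound is applied to the least common multiples up to \<open>N ^ k\<close>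
  and never to \<open>n\<close> itself. This keeps the dependence on \<open>D\<close> linear, which
  is essential because \<open>D\<close> will be as large as \<open>fact N\<close>.\<close>

lemma small_divisors_moment:
  fixes e :: real
  assumes "e > 0"
  shows "\<exists>C\<ge>1. \<forall>N\<ge>1. \<forall>D. (\<Sum>n\<in>{1..D}. real (card {b\<in>{1..N}. b dvd n}) ^ k)
           \<le> C * real N powr e * real D"
proof -
  \<comment> \<open>The divisor bound costs the exponent \<open>e' * k * k\<close> and the harmonic
    sum costs \<open>e' * k\<close>; together these are at most \<open>e\<close>.\<close>
  define e' where "e' = e / (2 * real (Suc k)^2)"
  have e': "e' > 0" using assms by (simp add: e'_def)
  obtain C where C: "C \<ge> 1" "\<And>n. n > 0 \<Longrightarrow> real (card {d::nat. d dvd n}) \<le> C * real n powr e'"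
    using divisor_bound[OF e'] by blast
  define K where "K = C ^ k * (1 + 1 / e')"
  have "(\<Sum>n\<in>{1..D}. real (card {b\<in>{1..N}. b dvd n}) ^ k) \<le> K * real N powr e * real D"
    if N: "N \<ge> 1" for N D
  proof -
    define B where "B = C * (real N ^ k) powr e'"
    have B0: "B \<ge> 0" using C by (simp add: B_def)
    have B: "real (card {d. d dvd L}) ^ k \<le> B ^ k" if "L \<in> {1..N^k}" for L
    proof -
      have "real (card {d. d dvd L}) \<le> C * real L powr e'" using C that by simp
      also have "\<dots> \<le> B"
        unfolding B_def using that C e' by (intro mult_left_mono powr_mono2) (auto simp flip: of_nat_power)
      finally show ?thesis by (intro power_mono) auto
    qed
    have "(\<Sum>n\<in>{1..D}. real (card {b\<in>{1..N}. b dvd n}) ^ k)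
       \<le> (\<Sum>n\<in>{1..D}. \<Sum>L\<in>{L\<in>{1..N^k}. L dvd n}. real (card {d. d dvd L}) ^ k)"
    proof (intro sum_mono)
      fix n assume "n \<in> {1..D}"
      then have "card {b\<in>{1..N}. b dvd n} ^ k \<le> (\<Sum>L\<in>{L\<in>{1..N^k}. L dvd n}. card {d. d dvd L} ^ k)"
        by (intro card_small_divisors_power_le) auto
      then show "real (card {b\<in>{1..N}. b dvd n}) ^ k
          \<le> (\<Sum>L\<in>{L\<in>{1..N^k}. L dvd n}. real (card {d. d dvd L}) ^ k)"
        by (metis (mono_tags, lifting) of_nat_le_iff of_nat_power of_nat_sum sum.cong)
    qed
    also have "\<dots> \<le> (\<Sum>n\<in>{1..D}. \<Sum>L\<in>{L\<in>{1..N^k}. L dvd n}. B ^ k)"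
      by (intro sum_mono B) auto
    also have "\<dots> = (\<Sum>L\<in>{1..N^k}. \<Sum>n\<in>{n\<in>{1..D}. L dvd n}. B ^ k)"
      by (rule sum.swap_restrict) auto
    also have "\<dots> = (\<Sum>L\<in>{1..N^k}. real (card {n\<in>{1..D}. L dvd n}) * B ^ k)"
      by simp
    also have "\<dots> \<le> (\<Sum>L\<in>{1..N^k}. real D / real L * B ^ k)"
      using B0 by (intro sum_mono mult_right_mono card_multiples_le) auto
    also have "\<dots> = B ^ k * real D * (\<Sum>L\<in>{1..N^k}. 1 / real L)"
      by (simp add: sum_distrib_left sum_distrib_right mult.commute)
    also have "\<dots> \<le> B ^ k * real D * ((1 + 1 / e') * real (N ^ k) powr e')"
      using N e' B0 by (intro mult_left_mono harm_le_powr) auto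
    also have "\<dots> = K * real N powr (e' * k * k + e' * k) * real D"
    proof -
      have "real (N ^ k) powr e' = real N powr (e' * k)"
        using N by (simp add: powr_powr powr_realpow[symmetric] mult.commute)
      moreover have "B = C * real N powr (e' * k)"
        using N by (simp add: B_def powr_powr powr_realpow[symmetric] mult.commute)
      then have "B ^ k = C ^ k * real N powr (e' * k * k)"
        using N by (simp add: power_mult_distrib powr_power mult_ac)
      ultimately show ?thesis
        by (simp add: K_def powr_add)
    qed
    also have "\<dots> \<le> K * real N powr e * real D"
    proof -
      have "e' * k * k + e' * k \<le> e' * (2 * real (Suc k)^2)"
        using e' by (simp add: power2_eq_square algebra_simps)
      also have "\<dots> = e" using assms by (simp add: e'_def)
      finally show ?thesis
        using N C e' by (intro mult_right_mono mult_left_mono powr_mono) (auto simp: K_def)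
    qed
    finally show ?thesis .
  qed
  moreover have "K \<ge> 1"
  proof -
    have "1 * 1 \<le> K" unfolding K_def using C(1) e' by (intro mult_mono) auto
    then show ?thesis by simp
  qed
  ultimately show ?thesis by blast
qed

section \<open>Exponential sums\<close>

text \<open>The norm equals \<open>2 * \<bar>sin (pi * x)\<bar>\<close>, and the sine is at least
  the distance from \<open>x\<close> to the nearest integer.\<close>

lemma norm_one_minus_cis:
  assumes "0 \<le> x" "x \<le> 1"
  shows "norm (1 - cis (2 * pi * x)) \<ge> 2 * min x (1 - x)"
proof -
  \<comment> \<open>With \<open>z = y / 2\<close>, monotonicity of \<open>sin z - z * cos z\<close>
    gives \<open>z * cos z \<le> sin z\<close>. The double angle formulas then yield
    \<open>sin y \<ge> 2 * (cos z)^2 * z \<ge> z\<close>, using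
    \<open>cos y \<ge> 0\<close>.\<close>
  have half: "y / 2 \<le> sin y" if "0 \<le> y" "y \<le> pi / 2" for y
  proof -
    define z where "z = y / 2"
    have z: "0 \<le> z" "z \<le> pi / 4" using that by (auto simp: z_def)
    have "(\<lambda>z. sin z - z * cos z) 0 \<le> (\<lambda>z. sin z - z * cos z) z"
    proof (rule DERIV_nonneg_imp_nondecreasing[where f = "\<lambda>z. sin z - z * cos z"])
      fix t assume t: "0 \<le> t" "t \<le> z"
      have "((\<lambda>z. sin z - z * cos z) has_real_derivative t * sin t) (at t)"
        by (auto intro!: derivative_eq_intros)
      moreover have "t * sin t \<ge> 0"
        using t z pi_ge_zero by (intro mult_nonneg_nonneg sin_ge_zero) linarith+
      ultimately show "\<exists>D. ((\<lambda>z. sin z - z * cos z) has_real_derivative D) (at t) \<and> 0 \<le> D"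
        by blast
    qed (use z in auto)
    then have 1: "z * cos z \<le> sin z" by simp
    have c0: "cos z \<ge> 0" using z by (intro cos_ge_zero) auto
    have "cos y \<ge> 0" using that by (intro cos_ge_zero) auto
    moreover have "cos y = 2 * (cos z)\<^sup>2 - 1"
      using cos_double_cos[of z] by (simp add: z_def)
    ultimately have "2 * (cos z)\<^sup>2 \<ge> 1" by simp
    then have "z * 1 \<le> z * (2 * (cos z)\<^sup>2)" using z by (intro mult_left_mono) auto
    also have "\<dots> = 2 * cos z * (z * cos z)" by (simp add: power2_eq_square)
    also have "\<dots> \<le> 2 * cos z * sin z" using 1 c0 by (intro mult_left_mono) auto
    also have "\<dots> = sin y" using sin_double[of z] by (simp add: z_def mult_ac)
    finally show ?thesis by (simp add: z_def)
  qed
  have *: "x' \<le> sin (pi * x')" if "0 \<le> x'" "x' \<le> 1 / 2" for x'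
  proof -
    have "pi * x' \<le> pi * (1 / 2)" using that by (intro mult_left_mono) auto
    then have "pi * x' / 2 \<le> sin (pi * x')"
      using that by (intro half) auto
    moreover have "x' * 2 \<le> x' * pi" using that pi_gt3 by (intro mult_left_mono) auto
    ultimately show ?thesis by (simp add: mult.commute)
  qed
  have "min x (1 - x) \<le> sin (pi * x)"
  proof (cases "x \<le> 1 / 2")
    case True
    then show ?thesis using *[of x] assms by simp
  next
    case False
    have "sin (pi * (1 - x)) = sin (pi * x)" by (simp add: right_diff_distrib sin_diff)
    then show ?thesis using *[of "1 - x"] assms False by simp
  qed
  then have "2 * min x (1 - x) \<le> 2 * \<bar>sin (pi * x)\<bar>" by simp
  also have "\<dots> = norm (1 - cis (2 * pi * x))"
    using dist_exp_i_1[of "2 * pi * x"]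
    by (simp add: cis_conv_exp norm_minus_commute mult.assoc)
  finally show ?thesis .
qed

lemma sum_int_symmetric_shift:
  fixes f :: "int \<Rightarrow> 'a::comm_monoid_add"
  shows "(\<Sum>a\<in>{- int N..int N}. f a) = (\<Sum>i\<le>2 * N. f (int i - int N))"
  by (rule sum.reindex_bij_witness[of _ "\<lambda>i. int i - int N" "\<lambda>a. nat (a + int N)"]) auto

lemma norm_sum_cis_le_trivial: "norm (\<Sum>a\<in>{- int N..int N}. cis (g a)) \<le> 2 * real N + 1"
proof -
  have "norm (\<Sum>a\<in>{- int N..int N}. cis (g a)) \<le> (\<Sum>a\<in>{- int N..int N}. norm (cis (g a)))"
    by (rule norm_sum)
  then show ?thesis by simp
qed

text \<open>A geometric sum with ratio \<open>w = cis (2 * pi * \<theta>)\<close>: the numerator has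
  norm at most 2, and the denominator at least \<open>2 * \<delta>\<close> because
  \<open>\<theta>\<close> keeps the distance \<open>\<delta>\<close> from the integers.\<close>

lemma norm_sum_cis_le:
  fixes \<theta> :: real and q :: int
  assumes "\<delta> > 0" "of_int q + \<delta> \<le> \<theta>" "\<theta> \<le> of_int q + 1 - \<delta>"
  shows "norm (\<Sum>a\<in>{- int N..int N}. cis (2 * pi * (of_int a * \<theta>))) \<le> 1 / \<delta>"
proof -
  define w where "w = cis (2 * pi * \<theta>)"
  define x where "x = \<theta> - of_int q"
  have "w = cis (2 * pi * x) * cis (2 * pi * of_int q)"
    unfolding w_def x_def cis_mult by (simp add: algebra_simps)
  then have w: "w = cis (2 * pi * x)" by simp
  have x: "0 \<le> x" "x \<le> 1" "\<delta> \<le> min x (1 - x)" using assms by (auto simp: x_def)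
  have lb: "norm (1 - w) \<ge> 2 * \<delta>"
    using norm_one_minus_cis[OF x(1,2)] x(3) unfolding w by (meson mult_left_mono order_trans zero_le_numeral)
  have "(\<Sum>a\<in>{- int N..int N}. cis (2 * pi * (of_int a * \<theta>)))
      = (\<Sum>i\<le>2 * N. cis (- (2 * pi * (real N * \<theta>))) * w ^ i)"
    unfolding sum_int_symmetric_shift
  proof (rule sum.cong[OF refl])
    fix i
    have "w ^ i = cis (real i * (2 * pi * \<theta>))" unfolding w_def by (rule Complex.DeMoivre)
    moreover have "2 * pi * (of_int (int i - int N) * \<theta>)
        = - (2 * pi * (real N * \<theta>)) + real i * (2 * pi * \<theta>)"
      by (simp add: algebra_simps)
    ultimately show "cis (2 * pi * (of_int (int i - int N) * \<theta>))
        = cis (- (2 * pi * (real N * \<theta>))) * w ^ i"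
      by (simp only: cis_mult)
  qed
  also have "\<dots> = cis (- (2 * pi * (real N * \<theta>))) * (\<Sum>i\<le>2 * N. w ^ i)"
    by (simp add: sum_distrib_left)
  finally have eq: "norm (\<Sum>a\<in>{- int N..int N}. cis (2 * pi * (of_int a * \<theta>))) = norm (\<Sum>i\<le>2 * N. w ^ i)"
    by (simp add: norm_mult)
  have "norm (1 - w) * norm (\<Sum>i\<le>2 * N. w ^ i) = norm (1 - w ^ Suc (2 * N))"
    unfolding norm_mult[symmetric] sum_gp_basic ..
  also have "\<dots> \<le> norm (1::complex) + norm (w ^ Suc (2 * N))" by (rule norm_triangle_ineq4)
  also have "\<dots> = 2" by (simp add: w_def norm_power norm_mult)
  finally have "norm (1 - w) * norm (\<Sum>i\<le>2 * N. w ^ i) \<le> 2" .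
  moreover have "2 * \<delta> * norm (\<Sum>i\<le>2 * N. w ^ i) \<le> norm (1 - w) * norm (\<Sum>i\<le>2 * N. w ^ i)"
    using lb by (intro mult_right_mono) auto
  ultimately show ?thesis unfolding eq using assms(1) by (simp add: field_simps)
qed

text \<open>Orthogonality of the additive characters modulo \<open>M\<close>: a geometric sum whose
  ratio is an \<open>M\<close>-th root of unity.\<close>

lemma sum_cis_residues:
  fixes M :: nat and t :: int
  assumes "M > 0"
  shows "(\<Sum>h<M. cis (2 * pi * (real h * of_int t / real M))) = (if int M dvd t then of_nat M else 0)"
proof -
  define w where "w = cis (2 * pi * (of_int t / real M))"
  have eq: "(\<Sum>h<M. cis (2 * pi * (real h * of_int t / real M))) = (\<Sum>h<M. w ^ h)"
  proof (rule sum.cong[OF refl])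
    fix h
    have "w ^ h = cis (real h * (2 * pi * (of_int t / real M)))" unfolding w_def by (rule Complex.DeMoivre)
    moreover have "2 * pi * (real h * of_int t / real M) = real h * (2 * pi * (of_int t / real M))"
      by simp
    ultimately show "cis (2 * pi * (real h * of_int t / real M)) = w ^ h" by (simp only:)
  qed
  have wM: "w ^ M = 1"
  proof -
    have "real M * (2 * pi * (of_int t / real M)) = 2 * pi * of_int t" using assms by simp
    then show ?thesis unfolding w_def Complex.DeMoivre by simp
  qed
  show ?thesis
  proof (cases "int M dvd t")
    case True
    then obtain s where "t = int M * s" by blast
    then have "w = 1" using assms by (simp add: w_def)
    then show ?thesis using True eq by simp
  next
    case False
    have "w \<noteq> 1"
    proof
      assume "w = 1"
      \<comment> \<open>\<open>x\<close> is the fractional part of \<open>t / M\<close>. It lies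
        strictly between 0 and 1, where the lower bound for
        \<open>norm (1 - cis (2 * pi * x))\<close> is positive.\<close>
      define x where "x = of_int t / real M - of_int (t div int M)"
      have tm: "of_int t = real M * of_int (t div int M) + of_int (t mod int M)"
        by (metis of_int_add of_int_mult of_int_of_nat_eq mult_div_mod_eq)
      have x: "x = of_int (t mod int M) / real M"
        using assms tm
        by (simp add: x_def diff_eq_eq nonzero_eq_divide_eq distrib_left distrib_right divide_eq_eq
            add.commute mult.commute)
      have r: "0 < t mod int M" "t mod int M < int M"
        using False assms pos_mod_sign[of "int M" t] pos_mod_bound[of "int M" t]
        unfolding dvd_eq_mod_eq_0 by linarith+
      have "real_of_int (t mod int M) < real_of_int (int M)"
        using r(2) by (simp only: of_int_less_iff)
      then have x01: "0 < x" "x < 1" unfolding x using assms r(1)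
        by (simp_all add: divide_less_eq)
      have "w = cis (2 * pi * x) * cis (2 * pi * of_int (t div int M))"
        unfolding w_def cis_mult by (simp add: x_def algebra_simps)
      then have "cis (2 * pi * x) = 1" using \<open>w = 1\<close> by simp
      then show False using norm_one_minus_cis[of x] x01 by auto
    qed
    then show ?thesis using False eq geometric_sum[of w M] wM by simp
  qed
qed

section \<open>Residues modulo \<open>M\<close> and modulo \<open>D\<close>\<close>

lemma cis_cong_mod:
  fixes M :: nat and x y s :: int
  assumes "M > 0" "x mod int M = y mod int M"
  shows "cis (2 * pi * (of_int (x * s) / real M)) = cis (2 * pi * (of_int (y * s) / real M))"
proof -
  have "int M dvd x - y" using assms(2) by (simp add: mod_eq_dvd_iff)
  then obtain q where q: "x = y + int M * q" by (metis dvdE add_diff_cancel_left' diff_add_cancel add.commute)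
  have "cis (2 * pi * (of_int (x * s) / real M))
      = cis (2 * pi * (of_int (y * s) / real M)) * cis (2 * pi * of_int (q * s))"
    unfolding cis_mult q using assms(1) by (intro arg_cong[of _ _ cis]) (simp add: field_simps)
  then show ?thesis by simp
qed

lemma bij_betw_affine_mod:
  fixes M :: nat and c u :: int
  assumes "M > 0" "coprime c (int M)"
  shows "bij_betw (\<lambda>h. (c * h + u) mod int M) {0..<int M} {0..<int M}"
proof -
  have "inj_on (\<lambda>h. (c * h + u) mod int M) {0..<int M}"
  proof (rule inj_onI)
    fix h h' assume h: "h \<in> {0..<int M}" "h' \<in> {0..<int M}"
      and "(c * h + u) mod int M = (c * h' + u) mod int M"
    then have "int M dvd c * (h - h')" by (simp add: mod_eq_dvd_iff algebra_simps)
    then have "int M dvd h - h'" using assms(2) by (simp add: coprime_dvd_mult_right_iff coprime_commute)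
    then have "h mod int M = h' mod int M" by (simp add: mod_eq_dvd_iff)
    then show "h = h'" using h by simp
  qed
  moreover have "(\<lambda>h. (c * h + u) mod int M) ` {0..<int M} \<subseteq> {0..<int M}"
    using assms(1) by auto
  ultimately show ?thesis
    by (simp add: bij_betw_def endo_inj_surj)
qed

lemma sum_affine_mod:
  fixes M :: nat and c u :: int
  assumes "M > 0" "coprime c (int M)"
  shows "(\<Sum>h\<in>{0..<int M}. f ((c * h + u) mod int M)) = (\<Sum>h\<in>{0..<int M}. f h)"
  by (rule sum.reindex_bij_betw[OF bij_betw_affine_mod[OF assms]])

lemma sum_periodic_shift:
  fixes D :: nat
  assumes "D > 0" "\<And>l. f (l mod int D) = f l"
  shows "(\<Sum>n\<in>{0..<int D}. f (n + u)) = (\<Sum>n\<in>{0..<int D}. f n)"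
  using sum_affine_mod[of D 1 f u] assms by simp

text \<open>The map \<open>z * D div M\<close> replaces \<open>z / M\<close> by a nearby fraction
  with denominator \<open>D\<close>. Each value is taken at most \<open>M / D + 1\<close> times, and
  this is at most \<open>2 * (M / D)\<close> since \<open>M \<ge> D\<close>.\<close>

lemma sum_scaled_div_le:
  fixes M D :: nat and g :: "int \<Rightarrow> real"
  assumes "D > 0" "M \<ge> D" "\<And>n. g n \<ge> 0"
  shows "(\<Sum>z\<in>{0..<int M}. g (z * int D div int M)) \<le> 2 * (real M / real D) * (\<Sum>n\<in>{0..<int D}. g n)"
proof -
  define \<nu> where "\<nu> z = z * int D div int M" for z
  have M: "M > 0" using assms by simp
  have bnd: "n * int M \<le> z * int D" "z * int D < (n + 1) * int M" if "\<nu> z = n" for z n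
  proof -
    have "z * int D = n * int M + z * int D mod int M"
      using that div_mult_mod_eq[of "z * int D" "int M"] by (simp add: \<nu>_def)
    moreover have "0 \<le> z * int D mod int M" "z * int D mod int M < int M" using M by auto
    ultimately show "n * int M \<le> z * int D" "z * int D < (n + 1) * int M"
      unfolding distrib_right by linarith+
  qed
  have img: "\<nu> ` {0..<int M} \<subseteq> {0..<int D}"
  proof
    fix n assume "n \<in> \<nu> ` {0..<int M}"
    then obtain z where z: "0 \<le> z" "z < int M" "n = z * int D div int M" by (auto simp: \<nu>_def)
    have "z * int D < int D * int M" using z assms(1) by (simp add: mult.commute)
    then have "n * int M < int D * int M" using bnd(1)[of z n] z(3) by (simp add: \<nu>_def)
    then have "n < int D" using M by simp
    moreover have "0 \<le> n" using z M by (simp add: pos_imp_zdiv_nonneg_iff)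
    ultimately show "n \<in> {0..<int D}" by simp
  qed
  have finZ: "finite {z\<in>{0..<int M}. \<nu> z = n}" for n
    by (rule finite_subset[of _ "{0..<int M}"]) auto
  have fib: "real (card {z\<in>{0..<int M}. \<nu> z = n}) \<le> 2 * (real M / real D)" for n
  proof (cases "{z\<in>{0..<int M}. \<nu> z = n} = {}")
    case True
    then show ?thesis by (simp only: card.empty) simp
  next
    case False
    \<comment> \<open>The fibre lies in an interval of \<open>M div D + 1\<close> integers that
      starts at its least element.\<close>
    define z0 where "z0 = Min {z\<in>{0..<int M}. \<nu> z = n}"
    have z0: "z0 \<in> {z\<in>{0..<int M}. \<nu> z = n}"
      unfolding z0_def using False finZ by (intro Min_in)
    have "{z\<in>{0..<int M}. \<nu> z = n} \<subseteq> {z0..z0 + int (M div D)}"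
    proof
      fix z assume z: "z \<in> {z\<in>{0..<int M}. \<nu> z = n}"
      then have "z0 \<le> z" unfolding z0_def using finZ by (intro Min_le)
      moreover have "(z - z0) * int D < int M"
      proof -
        have "n * int M \<le> z0 * int D" "z * int D < (n + 1) * int M"
          using z z0 bnd[of z n] bnd[of z0 n] by auto
        then show ?thesis by (simp add: algebra_simps)
      qed
      then have "(z - z0) * int D div int D \<le> int M div int D"
        using assms(1) by (intro zdiv_mono1) auto
      then have "z - z0 \<le> int M div int D" using assms(1) by simp
      ultimately show "z \<in> {z0..z0 + int (M div D)}" by (simp add: zdiv_int)
    qed
    then have "card {z\<in>{0..<int M}. \<nu> z = n} \<le> card {z0..z0 + int (M div D)}"
      by (intro card_mono) auto
    then have "real (card {z\<in>{0..<int M}. \<nu> z = n}) \<le> real (M div D) + 1" by simp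
    also have "\<dots> \<le> real M / real D + real M / real D"
      using assms of_nat_div_le_of_nat[of M D, where 'a = real] by (intro add_mono) (auto simp: field_simps)
    finally show ?thesis by simp
  qed
  have "(\<Sum>z\<in>{0..<int M}. g (\<nu> z)) = (\<Sum>n\<in>{0..<int D}. \<Sum>z\<in>{z\<in>{0..<int M}. \<nu> z = n}. g (\<nu> z))"
    using img by (intro sum.group[symmetric]) auto
  also have "\<dots> = (\<Sum>n\<in>{0..<int D}. real (card {z\<in>{0..<int M}. \<nu> z = n}) * g n)"
    by (intro sum.cong refl) simp
  also have "\<dots> \<le> (\<Sum>n\<in>{0..<int D}. 2 * (real M / real D) * g n)"
    using fib assms(3) by (intro sum_mono mult_right_mono) auto
  finally show ?thesis by (simp add: \<nu>_def sum_distrib_left)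
qed

text \<open>Every factor is at most the largest one, whose power occurs in the sum. This decouples
  the factors, so that each can be averaged over the frequencies by itself.\<close>

lemma prod_le_sum_power:
  fixes f :: "'a \<Rightarrow> real"
  assumes "finite J" "J \<noteq> {}" "\<And>j. j \<in> J \<Longrightarrow> f j \<ge> 0"
  shows "prod f J \<le> (\<Sum>j\<in>J. f j ^ card J)"
proof -
  define m where "m = Max (f ` J)"
  have m: "m \<in> f ` J" "\<And>j. j \<in> J \<Longrightarrow> f j \<le> m" using assms(1,2) by (auto simp: m_def)
  then obtain i where i: "i \<in> J" "m = f i" by blast
  have "prod f J \<le> (\<Prod>j\<in>J. m)" using assms m by (intro prod_mono) auto
  also have "\<dots> = f i ^ card J" using i by simp
  also have "\<dots> \<le> (\<Sum>j\<in>J. f j ^ card J)"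
    using assms i by (intro member_le_sum) auto
  finally show ?thesis .
qed

text \<open>With \<open>n = z * D div M\<close> and \<open>\<theta> = z * D / (M * b)\<close>, the
  number \<open>b * \<theta>\<close> lies between \<open>n\<close> and \<open>n + 1\<close>, so the
  fractional part of \<open>\<theta>\<close> lies between \<open>\<rho> / b\<close> and
  \<open>(\<rho> + 1) / b\<close>. The geometric sum can be large only if \<open>\<rho>\<close> is
  near \<open>0\<close> or near \<open>b\<close>, that is, if \<open>b\<close> divides an integer
  near \<open>n\<close>.\<close>

lemma norm_sum_cis_fraction_le:
  fixes z :: int and N M D b :: nat
  assumes "1 \<le> b" "b \<le> N" "b dvd D" "M > 0"
  defines "\<rho> \<equiv> (z * int D div int M) mod int b"
  shows "norm (\<Sum>a\<in>{- int N..int N}. cis (2 * pi * (of_int (z * (a * int (D div b))) / real M)))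
    \<le> 3 * real N * (1 / (1 + of_int \<rho>) + 1 / (real b - of_int \<rho>))"
    (is "norm ?G \<le> _")
proof -
  define n where "n = z * int D div int M"
  define q where "q = n div int b"
  define \<theta> where "\<theta> = of_int (z * int D) / (real M * real b)"
  have rho: "0 \<le> \<rho>" "\<rho> < int b" using assms(1) by (auto simp: \<rho>_def)
  then have rho': "0 \<le> real_of_int \<rho>" "1 \<le> real b - real_of_int \<rho>" by linarith+
  have G: "?G = (\<Sum>a\<in>{- int N..int N}. cis (2 * pi * (of_int a * \<theta>)))"
  proof (intro sum.cong refl)
    fix a :: int
    have "real (D div b) = real D / real b" using assms(3) by (rule real_of_nat_div)
    then have "of_int (z * (a * int (D div b))) / real M = of_int a * \<theta>"
      by (simp add: \<theta>_def mult_ac)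
    then show "cis (2 * pi * (of_int (z * (a * int (D div b))) / real M)) = cis (2 * pi * (of_int a * \<theta>))"
      by (simp only:)
  qed
  have n: "n = q * int b + \<rho>" unfolding q_def \<rho>_def n_def by simp
  have "n * int M \<le> z * int D" "z * int D < (n + 1) * int M"
  proof -
    have "z * int D = n * int M + z * int D mod int M" unfolding n_def by simp
    moreover have "0 \<le> z * int D mod int M" "z * int D mod int M < int M" using assms(4) by auto
    ultimately show "n * int M \<le> z * int D" "z * int D < (n + 1) * int M"
      unfolding distrib_right by linarith+
  qed
  then have "real_of_int (n * int M) \<le> of_int (z * int D)"
    "real_of_int (z * int D) < of_int ((n + 1) * int M)"
    by (simp_all only: of_int_le_iff of_int_less_iff)
  then have y: "of_int n \<le> real b * \<theta>" "real b * \<theta> < of_int n + 1"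
    using assms(1,4) by (simp_all add: \<theta>_def field_simps)
  show ?thesis
  \<comment> \<open>In these two cases \<open>\<theta>\<close> may be arbitrarily close to an
    integer. The trivial bound is used, and one of the two fractions on the right equals 1.\<close>
  proof (cases "\<rho> = 0 \<or> \<rho> = int b - 1")
    case True
    have "norm ?G \<le> 2 * real N + 1" by (rule norm_sum_cis_le_trivial)
    also have "\<dots> \<le> 3 * real N * 1" using assms(1,2) by simp
    also have "1 \<le> 1 / (1 + of_int \<rho>) + 1 / (real b - of_int \<rho>)"
      using True rho' by auto
    then have "3 * real N * 1 \<le> 3 * real N * (1 / (1 + of_int \<rho>) + 1 / (real b - of_int \<rho>))"
      by (intro mult_left_mono) auto
    finally show ?thesis .
  next
    case False
    \<comment> \<open>\<open>\<mu> / b\<close> bounds the distance from \<open>\<theta>\<close> to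
      the integers from below; the \<open>- 1\<close> allows for \<open>b * \<theta>\<close> being
      known only up to 1. Since \<open>\<mu> \<ge> 1\<close>, \<open>1 / \<mu>\<close> may be
      replaced by a multiple of \<open>1 / (1 + \<mu>)\<close>.\<close>
    define \<mu> where "\<mu> = min (real_of_int \<rho>) (real b - 1 - of_int \<rho>)"
    have "1 \<le> \<rho>" "1 \<le> int b - 1 - \<rho>" using False rho by auto
    then have "1 \<le> real_of_int \<rho>" "1 \<le> real b - 1 - real_of_int \<rho>" by linarith+
    then have mu: "1 \<le> \<mu>" by (simp add: \<mu>_def)
    have b0: "real b > 0" using assms(1) by simp
    have qn: "real_of_int n = of_int q * real b + of_int \<rho>" using n by simp
    have "(of_int q + \<mu> / real b) * real b \<le> \<theta> * real b"
      using y b0 qn unfolding distrib_right by (simp add: \<mu>_def mult.commute)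
    then have 1: "of_int q + \<mu> / real b \<le> \<theta>" using b0 by simp
    have "\<theta> * real b \<le> (of_int q + 1 - \<mu> / real b) * real b"
      using y b0 qn unfolding distrib_right left_diff_distrib by (simp add: \<mu>_def mult.commute)
    then have 2: "\<theta> \<le> of_int q + 1 - \<mu> / real b" using b0 by simp
    have "norm ?G \<le> 1 / (\<mu> / real b)"
      unfolding G using mu b0 by (intro norm_sum_cis_le[OF _ 1 2]) auto
    also have "\<dots> = real b / \<mu>" by simp
    also have "\<dots> \<le> real N / \<mu>" using assms(2) mu by (intro divide_right_mono) auto
    also have "\<dots> \<le> 3 * real N * (1 / (1 + \<mu>))"
      using mu assms by (simp add: field_simps mult_left_mono)
    also have "1 / (1 + \<mu>) \<le> 1 / (1 + of_int \<rho>) + 1 / (real b - of_int \<rho>)"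
    proof (cases "real_of_int \<rho> \<le> real b - 1 - of_int \<rho>")
      case True
      then have "\<mu> = of_int \<rho>" by (simp add: \<mu>_def)
      then show ?thesis using rho' by simp
    next
      case False
      then have "1 + \<mu> = real b - of_int \<rho>" by (simp add: \<mu>_def)
      then show ?thesis using rho' by simp
    qed
    then have "3 * real N * (1 / (1 + \<mu>)) \<le> 3 * real N * (1 / (1 + of_int \<rho>) + 1 / (real b - of_int \<rho>))"
      by (intro mult_left_mono) auto
    finally show ?thesis .
  qed
qed

text \<open>The argument is an integer because shifts can make it negative. At \<open>l = 0\<close>
  the set is all of \<open>{1..N}\<close>, in accordance with periodicity modulo a common multiple
  of \<open>1, ..., N\<close>.\<close>

definition small_divisors :: "nat \<Rightarrow> int \<Rightarrow> nat set" where
  "small_divisors N l = {b\<in>{1..N}. int b dvd l}"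

text \<open>The weight of an integer at distance \<open>\<bar>u\<bar>\<close> from the central one;
  the \<open>max\<close> gives \<open>u = 0\<close> the weight 1.\<close>

definition decay :: "int \<Rightarrow> real" where
  "decay u = 1 / max 1 \<bar>of_int u\<bar>"

lemma decay_nonneg: "decay u \<ge> 0"
  by (simp add: decay_def)

text \<open>The multiples of \<open>b\<close> around \<open>n\<close> are \<open>n - \<rho>\<close>
  and \<open>n + (b - \<rho>)\<close>, so the bound for a single \<open>b\<close> is part of a sum
  over shifts \<open>u\<close> with \<open>b dvd n + u\<close>. Exchanging the sums turns the sum
  over \<open>b\<close> into divisor counts of the integers near \<open>n\<close>.\<close>

lemma sum_norm_sum_cis_fraction_le:
  fixes z :: int and N M D :: nat
  assumes "M > 0" "\<And>b. b \<in> {1..N} \<Longrightarrow> b dvd D"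
  defines "n \<equiv> z * int D div int M"
  shows "(\<Sum>b\<in>{1..N}. norm (\<Sum>a\<in>{- int N..int N}. cis (2 * pi * (of_int (z * (a * int (D div b))) / real M))))
    \<le> 3 * real N * (\<Sum>u\<in>{- int N..int N}. decay u * real (card (small_divisors N (n + u))))"
proof -
  have "(\<Sum>b\<in>{1..N}. norm (\<Sum>a\<in>{- int N..int N}. cis (2 * pi * (of_int (z * (a * int (D div b))) / real M))))
    \<le> (\<Sum>b\<in>{1..N}. 3 * real N * (\<Sum>u\<in>{u\<in>{- int N..int N}. int b dvd n + u}. decay u))"
  proof (rule sum_mono)
    fix b assume b: "b \<in> {1..N}"
    define \<rho> where "\<rho> = n mod int b"
    have rho: "0 \<le> \<rho>" "\<rho> < int b" using b by (auto simp: \<rho>_def)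
    have "int b dvd n - \<rho>" by (simp add: \<rho>_def)
    then have "{- \<rho>, int b - \<rho>} \<subseteq> {u\<in>{- int N..int N}. int b dvd n + u}"
      using b rho dvd_add_right_iff[of "int b" "int b" "n - \<rho>"] by (auto simp: algebra_simps)
    then have "(\<Sum>u\<in>{- \<rho>, int b - \<rho>}. decay u) \<le> (\<Sum>u\<in>{u\<in>{- int N..int N}. int b dvd n + u}. decay u)"
      by (intro sum_mono2 finite_subset[of "{u\<in>{- int N..int N}. int b dvd n + u}" "{- int N..int N}"])
         (auto simp: decay_nonneg)
    moreover have "(\<Sum>u\<in>{- \<rho>, int b - \<rho>}. decay u) = decay (- \<rho>) + decay (int b - \<rho>)"
      using b by simp
    moreover have "1 / (1 + of_int \<rho>) \<le> decay (- \<rho>)"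
      using rho unfolding decay_def by (intro divide_left_mono) auto
    moreover have "1 / (real b - of_int \<rho>) = decay (int b - \<rho>)"
    proof -
      have "1 \<le> real b - of_int \<rho>" using rho by linarith
      then show ?thesis by (simp add: decay_def)
    qed
    ultimately have "1 / (1 + of_int \<rho>) + 1 / (real b - of_int \<rho>)
        \<le> (\<Sum>u\<in>{u\<in>{- int N..int N}. int b dvd n + u}. decay u)" by linarith
    then have "3 * real N * (1 / (1 + of_int \<rho>) + 1 / (real b - of_int \<rho>))
        \<le> 3 * real N * (\<Sum>u\<in>{u\<in>{- int N..int N}. int b dvd n + u}. decay u)"
      by (intro mult_left_mono) auto
    moreover have "norm (\<Sum>a\<in>{- int N..int N}. cis (2 * pi * (of_int (z * (a * int (D div b))) / real M)))
        \<le> 3 * real N * (1 / (1 + of_int \<rho>) + 1 / (real b - of_int \<rho>))"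
      unfolding \<rho>_def n_def using b assms(1,2) by (intro norm_sum_cis_fraction_le) auto
    ultimately show "norm (\<Sum>a\<in>{- int N..int N}. cis (2 * pi * (of_int (z * (a * int (D div b))) / real M)))
        \<le> 3 * real N * (\<Sum>u\<in>{u\<in>{- int N..int N}. int b dvd n + u}. decay u)"
      by (rule order_trans[rotated])
  qed
  also have "\<dots> = 3 * real N * (\<Sum>b\<in>{1..N}. \<Sum>u\<in>{u\<in>{- int N..int N}. int b dvd n + u}. decay u)"
    by (simp add: sum_distrib_left)
  also have "(\<Sum>b\<in>{1..N}. \<Sum>u\<in>{u\<in>{- int N..int N}. int b dvd n + u}. decay u)
      = (\<Sum>u\<in>{- int N..int N}. \<Sum>b\<in>{b\<in>{1..N}. int b dvd n + u}. decay u)"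
    by (rule sum.swap_restrict) auto
  also have "\<dots> = (\<Sum>u\<in>{- int N..int N}. decay u * real (card (small_divisors N (n + u))))"
    by (simp add: small_divisors_def mult.commute)
  finally show ?thesis .
qed

lemma small_divisors_mod:
  assumes "\<And>b. b \<in> {1..N} \<Longrightarrow> b dvd D"
  shows "small_divisors N (l mod int D) = small_divisors N l"
  using assms by (auto simp: small_divisors_def dvd_mod_iff)

text \<open>Once the factors are separated, multiplication by \<open>c j\<close> permutes the
  frequencies because it is invertible modulo \<open>M\<close>, and the shift \<open>u j\<close>
  disappears by periodicity modulo \<open>D\<close>. The bound therefore contains neither
  \<open>c\<close> nor \<open>u\<close>.\<close>

lemma sum_prod_small_divisors_le:
  fixes c u :: "'j \<Rightarrow> int" and N M D :: nat
  assumes J: "finite J" "J \<noteq> {}" and D: "D > 0" "M \<ge> D" "\<And>b. b \<in> {1..N} \<Longrightarrow> b dvd D"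
    and c: "\<And>j. j \<in> J \<Longrightarrow> coprime (c j) (int M)"
  shows "(\<Sum>h\<in>{0..<int M}. \<Prod>j\<in>J. real (card (small_divisors N ((c j * h) mod int M * int D div int M + u j))))
    \<le> 2 * real (card J) * (real M / real D) * (\<Sum>n\<in>{1..D}. real (card {b\<in>{1..N}. b dvd n}) ^ card J)"
proof -
  let ?d = "\<lambda>l. real (card (small_divisors N l))"
  have dmod: "?d (l mod int D) = ?d l" for l using small_divisors_mod[of N D l] D(3) by simp
  \<comment> \<open>Periodicity removes the shift \<open>v\<close>. A further shift by 1 moves the
    range to \<open>{1..D}\<close>, where the moment bound is stated and \<open>D\<close> represents
    the residue 0.\<close>
  have S: "(\<Sum>n\<in>{0..<int D}. ?d (n + v) ^ card J) = (\<Sum>n\<in>{1..D}. real (card {b\<in>{1..N}. b dvd n}) ^ card J)" for v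
  proof -
    have "(\<Sum>n\<in>{0..<int D}. ?d (n + v) ^ card J) = (\<Sum>n\<in>{0..<int D}. ?d n ^ card J)"
      using D(1) dmod by (intro sum_periodic_shift[where f = "\<lambda>l. ?d l ^ card J"]) auto
    also have "\<dots> = (\<Sum>n\<in>{0..<int D}. ?d (n + 1) ^ card J)"
      using D(1) dmod by (intro sum_periodic_shift[where f = "\<lambda>l. ?d l ^ card J", symmetric]) auto
    also have "\<dots> = (\<Sum>n\<in>{1..D}. ?d (int n) ^ card J)"
      by (rule sum.reindex_bij_witness[of _ "\<lambda>n. int n - 1" "\<lambda>n. nat (n + 1)"]) auto
    finally show ?thesis by (simp add: small_divisors_def)
  qed
  have "(\<Sum>h\<in>{0..<int M}. \<Prod>j\<in>J. ?d ((c j * h) mod int M * int D div int M + u j))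
    \<le> (\<Sum>h\<in>{0..<int M}. \<Sum>j\<in>J. ?d ((c j * h) mod int M * int D div int M + u j) ^ card J)"
    using J by (intro sum_mono prod_le_sum_power) auto
  also have "\<dots> = (\<Sum>j\<in>J. \<Sum>h\<in>{0..<int M}. ?d ((c j * h) mod int M * int D div int M + u j) ^ card J)"
    by (rule sum.swap)
  also have "\<dots> = (\<Sum>j\<in>J. \<Sum>h\<in>{0..<int M}. ?d (h * int D div int M + u j) ^ card J)"
  proof (rule sum.cong[OF refl])
    fix j assume "j \<in> J"
    then show "(\<Sum>h\<in>{0..<int M}. ?d ((c j * h) mod int M * int D div int M + u j) ^ card J)
      = (\<Sum>h\<in>{0..<int M}. ?d (h * int D div int M + u j) ^ card J)"
      using sum_affine_mod[of M "c j" "\<lambda>h. ?d (h * int D div int M + u j) ^ card J" 0] c D by simp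
  qed
  also have "\<dots> \<le> (\<Sum>j\<in>J. 2 * (real M / real D) * (\<Sum>n\<in>{0..<int D}. ?d (n + u j) ^ card J))"
    using D by (intro sum_mono sum_scaled_div_le) auto
  also have "\<dots> = 2 * real (card J) * (real M / real D) * (\<Sum>n\<in>{1..D}. real (card {b\<in>{1..N}. b dvd n}) ^ card J)"
    by (simp add: S)
  finally show ?thesis .
qed

section \<open>Linear equations in rationals of bounded height\<close>

lemma cis_sum: "cis (\<Sum>j\<in>J. f j) = (\<Prod>j\<in>J. cis (f j))"
  by (induction J rule: infinite_finite_induct) (simp_all flip: cis_mult)

text \<open>Relaxing \<open>t f = 0\<close> to \<open>int M dvd t f\<close> only enlarges the count,
  and the characters modulo \<open>M\<close> detect the latter exactly.\<close>

lemma sum_dvd_indicator_le: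
  fixes t :: "'f \<Rightarrow> int" and M :: nat
  assumes "finite A" "M > 0"
  shows "real M * real (card {f\<in>A. t f = 0})
    \<le> norm (\<Sum>h<M. \<Sum>f\<in>A. cis (2 * pi * (real h * of_int (t f) / real M)))"
proof -
  have "real M * real (card {f\<in>A. t f = 0}) = (\<Sum>f\<in>{f\<in>A. t f = 0}. real M)" by simp
  also have "\<dots> \<le> (\<Sum>f\<in>{f\<in>A. int M dvd t f}. real M)"
    using assms(1) by (intro sum_mono2) auto
  also have "\<dots> = norm (\<Sum>f\<in>{f\<in>A. int M dvd t f}. complex_of_nat M)"
    by (simp add: norm_mult)
  also have "(\<Sum>f\<in>{f\<in>A. int M dvd t f}. complex_of_nat M) = (\<Sum>f\<in>A. if int M dvd t f then of_nat M else 0)"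
    using assms(1) by (rule sum.inter_filter)
  also have "\<dots> = (\<Sum>f\<in>A. \<Sum>h<M. cis (2 * pi * (real h * of_int (t f) / real M)))"
    using sum_cis_residues[OF assms(2)] by simp
  also have "\<dots> = (\<Sum>h<M. \<Sum>f\<in>A. cis (2 * pi * (real h * of_int (t f) / real M)))"
    by (rule sum.swap)
  finally show ?thesis .
qed

text \<open>\<open>D\<close> is a common multiple of the denominators, so the equation multiplied by
  \<open>D\<close> is integral. The coefficients enter only through coprimality with the modulus
  \<open>M\<close>, and the factor \<open>M\<close> cancels, so the bound is uniform in
  \<open>c\<close>.\<close>

lemma card_integer_solutions_le:
  fixes c :: "'j \<Rightarrow> int" and N D :: nat
  assumes J: "finite J" "J \<noteq> {}" and D: "D > 0" "\<And>b. b \<in> {1..N} \<Longrightarrow> b dvd D"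
    and c: "\<And>j. j \<in> J \<Longrightarrow> c j \<noteq> 0"
  shows "real (card {f \<in> J \<rightarrow>\<^sub>E {- int N..int N} \<times> {1..N}.
      (\<Sum>j\<in>J. c j * (fst (f j) * int (D div snd (f j)))) = 0})
    \<le> 2 * real (card J) * (3 * real N * (\<Sum>u\<in>{- int N..int N}. decay u)) ^ card J
      * (\<Sum>n\<in>{1..D}. real (card {b\<in>{1..N}. b dvd n}) ^ card J) / real D"
proof -
  define P where "P = nat \<bar>prod c J\<bar>"
  \<comment> \<open>This modulus is congruent to 1 modulo every \<open>c j\<close>, hence coprime to
    it, and it is at least \<open>D\<close>.\<close>
  define M where "M = 1 + D * P"
  define B where "B = {- int N..int N} \<times> {1..N}"
  define s where "s p = fst p * int (D div snd p)" for p :: "int \<times> nat"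
  define t where "t f = (\<Sum>j\<in>J. c j * s (f j))" for f
  let ?U = "{- int N..int N}"
  let ?d = "\<lambda>l. real (card (small_divisors N l))"
  define \<nu> where "\<nu> j h = (c j * h) mod int M * int D div int M" for j h
  define mu where "mu = (\<Sum>n\<in>{1..D}. real (card {b\<in>{1..N}. b dvd n}) ^ card J)"
  have "P > 0" using J c by (simp add: P_def)
  then have "D \<le> D * P" by simp
  then have M: "M > 0" "M \<ge> D" unfolding M_def by linarith+
  have cop: "coprime (c j) (int M)" if "j \<in> J" for j
  proof (rule coprimeI)
    fix d assume d: "d dvd c j" "d dvd int M"
    have "c j dvd int P" using that J by (simp add: P_def dvd_prodI)
    then have "d dvd int D * int P" using d(1) by (meson dvd_mult dvd_trans)
    moreover have "int M = 1 + int D * int P" by (simp add: M_def)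
    ultimately show "is_unit d" using d(2) by (metis dvd_add_left_iff)
  qed
  have finB: "finite B" by (simp add: B_def)
  have G: "norm (\<Sum>p\<in>B. cis (2 * pi * (of_int (c j * h * s p) / real M)))
      \<le> 3 * real N * (\<Sum>u\<in>?U. decay u * ?d (\<nu> j h + u))" for j h
  proof -
    have "(\<Sum>p\<in>B. cis (2 * pi * (of_int (c j * h * s p) / real M)))
        = (\<Sum>p\<in>B. cis (2 * pi * (of_int ((c j * h) mod int M * s p) / real M)))"
      using M(1) by (intro sum.cong refl cis_cong_mod) auto
    also have "\<dots> = (\<Sum>b\<in>{1..N}. \<Sum>a\<in>?U.
        cis (2 * pi * (of_int ((c j * h) mod int M * (a * int (D div b))) / real M)))"
      unfolding B_def s_def by (subst sum.swap) (simp only: sum.cartesian_product case_prod_unfold)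
    also have "norm \<dots> \<le> (\<Sum>b\<in>{1..N}. norm (\<Sum>a\<in>?U.
        cis (2 * pi * (of_int ((c j * h) mod int M * (a * int (D div b))) / real M))))"
      by (rule norm_sum)
    also have "\<dots> \<le> 3 * real N * (\<Sum>u\<in>?U. decay u * ?d (\<nu> j h + u))"
      unfolding \<nu>_def using M(1) D(2) by (rule sum_norm_sum_cis_fraction_le)
    finally show ?thesis .
  qed
  have "real M * real (card {f \<in> J \<rightarrow>\<^sub>E B. t f = 0})
      \<le> norm (\<Sum>h<M. \<Sum>f\<in>J \<rightarrow>\<^sub>E B. cis (2 * pi * (real h * of_int (t f) / real M)))"
    using J(1) finB M(1) by (intro sum_dvd_indicator_le finite_PiE) auto
  \<comment> \<open>For a fixed frequency \<open>h\<close> the unknowns are independent, so the sum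
    over \<open>f\<close> factors into one sum over fractions per coordinate.\<close>
  also have "\<dots> = norm (\<Sum>h<M. \<Prod>j\<in>J. \<Sum>p\<in>B. cis (2 * pi * (of_int (c j * int h * s p) / real M)))"
  proof (intro arg_cong[of _ _ norm] sum.cong refl)
    fix h :: nat
    have "cis (2 * pi * (real h * of_int (t f) / real M))
        = (\<Prod>j\<in>J. cis (2 * pi * (of_int (c j * int h * s (f j)) / real M)))" for f
    proof -
      have "2 * pi * (real h * of_int (t f) / real M)
          = (\<Sum>j\<in>J. 2 * pi * (of_int (c j * int h * s (f j)) / real M))"
        by (simp add: t_def sum_distrib_left sum_divide_distrib mult_ac)
      then show ?thesis by (simp only: cis_sum)
    qed
    then show "(\<Sum>f\<in>J \<rightarrow>\<^sub>E B. cis (2 * pi * (real h * of_int (t f) / real M)))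
        = (\<Prod>j\<in>J. \<Sum>p\<in>B. cis (2 * pi * (of_int (c j * int h * s p) / real M)))"
      using J(1) finB by (subst prod_sum_PiE) auto
  qed
  also have "\<dots> \<le> (\<Sum>h<M. \<Prod>j\<in>J. norm (\<Sum>p\<in>B. cis (2 * pi * (of_int (c j * int h * s p) / real M))))"
    unfolding prod_norm by (rule norm_sum)
  also have "\<dots> \<le> (\<Sum>h<M. \<Prod>j\<in>J. 3 * real N * (\<Sum>u\<in>?U. decay u * ?d (\<nu> j (int h) + u)))"
    by (intro sum_mono prod_mono conjI G) auto
  \<comment> \<open>Expanding the product of sums gives a sum over vectors \<open>v\<close> of
    shifts. Their weights do not depend on \<open>h\<close>, so the sum over \<open>h\<close> can be
    carried out for each \<open>v\<close>.\<close>
  also have "\<dots> = (\<Sum>h<M. (3 * real N) ^ card J * (\<Sum>v\<in>J \<rightarrow>\<^sub>E ?U. (\<Prod>j\<in>J. decay (v j)) * (\<Prod>j\<in>J. ?d (\<nu> j (int h) + v j))))"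
    using J(1) by (simp add: prod.distrib prod_sum_PiE)
  also have "\<dots> = (3 * real N) ^ card J * (\<Sum>v\<in>J \<rightarrow>\<^sub>E ?U. (\<Prod>j\<in>J. decay (v j)) * (\<Sum>h<M. \<Prod>j\<in>J. ?d (\<nu> j (int h) + v j)))"
    unfolding sum_distrib_left[symmetric] by (subst sum.swap) (simp add: sum_distrib_left)
  also have "\<dots> \<le> (3 * real N) ^ card J * (\<Sum>v\<in>J \<rightarrow>\<^sub>E ?U. (\<Prod>j\<in>J. decay (v j)) * (2 * real (card J) * (real M / real D) * mu))"
  proof (intro mult_left_mono sum_mono prod_nonneg decay_nonneg)
    fix v :: "'j \<Rightarrow> int"
    have "(\<Sum>h<M. \<Prod>j\<in>J. ?d (\<nu> j (int h) + v j)) = (\<Sum>h\<in>{0..<int M}. \<Prod>j\<in>J. ?d (\<nu> j h + v j))"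
      by (rule sum.reindex_bij_witness[of _ nat int]) auto
    also have "\<dots> \<le> 2 * real (card J) * (real M / real D) * mu"
      unfolding \<nu>_def mu_def using J D(1) M(2) D(2) cop by (rule sum_prod_small_divisors_le)
    finally show "(\<Sum>h<M. \<Prod>j\<in>J. ?d (\<nu> j (int h) + v j)) \<le> 2 * real (card J) * (real M / real D) * mu" .
  qed auto
  also have "\<dots> = (3 * real N) ^ card J * (\<Sum>u\<in>?U. decay u) ^ card J * (2 * real (card J) * (real M / real D) * mu)"
  proof -
    have "(\<Sum>v\<in>J \<rightarrow>\<^sub>E ?U. \<Prod>j\<in>J. decay (v j)) = (\<Sum>u\<in>?U. decay u) ^ card J"
      using prod_sum_PiE[of J "\<lambda>_. ?U" "\<lambda>_. decay"] J(1) by simp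
    then show ?thesis by (simp only: sum_distrib_right[symmetric] mult.assoc)
  qed
  also have "\<dots> = real M * (2 * real (card J) * (3 * real N * (\<Sum>u\<in>?U. decay u)) ^ card J * mu / real D)"
    by (simp add: power_mult_distrib)
  finally have "real (card {f \<in> J \<rightarrow>\<^sub>E B. t f = 0})
      \<le> 2 * real (card J) * (3 * real N * (\<Sum>u\<in>?U. decay u)) ^ card J * mu / real D"
    using M(1) by (simp only: mult_le_cancel_left_pos of_nat_0_less_iff)
  then show ?thesis by (simp only: B_def t_def s_def mu_def)
qed

section \<open>Passing to rational unknowns and coefficients\<close>

lemma sum_decay_le:
  fixes e :: real
  assumes "e > 0" "N \<ge> 1"
  shows "(\<Sum>u\<in>{- int N..int N}. decay u) \<le> 3 * (1 + 1 / e) * real N powr e"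
proof -
  let ?h = "\<Sum>l\<in>{1..N}. 1 / real l"
  have "{- int N..int N} = {0} \<union> int ` {1..N} \<union> (\<lambda>l. - int l) ` {1..N}"
  proof (intro equalityI subsetI)
    fix u assume u: "u \<in> {- int N..int N}"
    consider "u = 0" | "u > 0" | "u < 0" by linarith
    then show "u \<in> {0} \<union> int ` {1..N} \<union> (\<lambda>l. - int l) ` {1..N}"
    proof cases
      case 2
      then have "u \<in> int ` {1..N}" using u by (intro image_eqI[of _ _ "nat u"]) auto
      then show ?thesis by simp
    next
      case 3
      then have "u \<in> (\<lambda>l. - int l) ` {1..N}" using u by (intro image_eqI[of _ _ "nat (- u)"]) auto
      then show ?thesis by simp
    qed simp
  qed auto
  then have "(\<Sum>u\<in>{- int N..int N}. decay u) = (\<Sum>u\<in>{0} \<union> int ` {1..N} \<union> (\<lambda>l. - int l) ` {1..N}. decay u)"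
    by simp
  also have "\<dots> = decay 0 + (\<Sum>u\<in>int ` {1..N}. decay u) + (\<Sum>u\<in>(\<lambda>l. - int l) ` {1..N}. decay u)"
    by (subst sum.union_disjoint; (subst sum.union_disjoint)?) auto
  also have "(\<Sum>u\<in>int ` {1..N}. decay u) = ?h"
    by (subst sum.reindex) (auto simp: decay_def inj_on_def intro!: sum.cong)
  also have "(\<Sum>u\<in>(\<lambda>l. - int l) ` {1..N}. decay u) = ?h"
    by (subst sum.reindex) (auto simp: decay_def inj_on_def intro!: sum.cong)
  finally have eq: "(\<Sum>u\<in>{- int N..int N}. decay u) = 1 + ?h + ?h" by (simp add: decay_def)
  have "1 * 1 \<le> (1 + 1 / e) * real N powr e"
    using assms by (intro mult_mono ge_one_powr_ge_zero) auto
  then show ?thesis using harm_le_powr[OF assms] unfolding eq by linarith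
qed

lemma height_rats_subset:
  assumes "x \<in> height_rats H" "N = nat \<lfloor>H\<rfloor>"
  shows "\<exists>p\<in>{- int N..int N} \<times> {1..N}. x = of_int (fst p) / of_nat (snd p)"
proof -
  obtain a b :: int where x: "x = of_int a / of_int b" and ab: "b > 0" "\<bar>real_of_int a\<bar> \<le> H" "real_of_int b \<le> H"
    using assms(1) unfolding height_rats_def by blast
  have "\<bar>a\<bar> \<le> \<lfloor>H\<rfloor>" "b \<le> \<lfloor>H\<rfloor>"
    using ab by (simp_all add: le_floor_iff)
  moreover from this ab(1) have "0 \<le> \<lfloor>H\<rfloor>" by linarith
  ultimately have "(a, nat b) \<in> {- int N..int N} \<times> {1..N}"
    using ab(1) assms(2) by auto
  moreover have "x = of_int (fst (a, nat b)) / of_nat (snd (a, nat b))"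
    using ab(1) x by (simp add: of_nat_nat)
  ultimately show ?thesis by blast
qed

lemma card_height_rats_le:
  assumes "H \<ge> 1"
  shows "real (card (height_rats H)) \<le> 3 * H powr 2"
proof -
  define N where "N = nat \<lfloor>H\<rfloor>"
  have N: "N \<ge> 1" "real N \<le> H" using assms unfolding N_def by linarith+
  have "height_rats H \<subseteq> (\<lambda>p. of_int (fst p) / of_nat (snd p)) ` ({- int N..int N} \<times> {1..N})"
    using height_rats_subset[OF _ N_def] by blast
  then have "card (height_rats H) \<le> card ({- int N..int N} \<times> {1..N})"
    by (intro surj_card_le) auto
  also have "\<dots> = (2 * N + 1) * N"
  proof -
    have "card {- int N..int N} = 2 * N + 1" by (simp add: nat_eq_iff)
    then show ?thesis by (simp add: card_cartesian_product del: card_atLeastAtMost_int)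
  qed
  also have "\<dots> \<le> (3 * N) * N" using N(1) by (intro mult_le_mono1) auto
  finally have "real (card (height_rats H)) \<le> real (3 * N * N)" by (simp only: of_nat_le_iff)
  also have "\<dots> = 3 * (real N)\<^sup>2" by (simp add: power2_eq_square)
  also have "\<dots> \<le> 3 * H\<^sup>2" using N by (intro mult_left_mono power_mono) auto
  also have "H\<^sup>2 = H powr 2" using assms by simp
  finally show ?thesis .
qed

lemma zero_in_height_rats: "H \<ge> 1 \<Longrightarrow> 0 \<in> height_rats H"
  unfolding height_rats_def by (rule CollectI, rule exI[of _ 0], rule exI[of _ 1]) auto

lemma common_denominator:
  fixes c :: "'j \<Rightarrow> rat"
  assumes "finite J"
  shows "\<exists>Q>0. \<exists>c'. \<forall>j\<in>J. of_int (c' j) = of_int Q * c j"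
proof -
  define q where "q j = snd (quotient_of (c j))" for j
  have q: "q j > 0" "c j = of_int (fst (quotient_of (c j))) / of_int (q j)" for j
    unfolding q_def using quotient_of_denom_pos' quotient_of_div[of "c j" "fst (quotient_of (c j))" "snd (quotient_of (c j))"]
    by auto
  have "of_int (fst (quotient_of (c j)) * prod q (J - {j})) = of_int (prod q J) * c j" if "j \<in> J" for j
  proof -
    have "prod q J = q j * prod q (J - {j})" using assms that by (rule prod.remove)
    moreover have "of_int (q j) * c j = of_int (fst (quotient_of (c j)))"
      using q(1)[of j] by (subst q(2)) simp
    ultimately show ?thesis by (simp add: mult_ac)
  qed
  moreover have "prod q J > 0" using q(1) by (intro prod_pos) auto
  ultimately show ?thesis by (intro exI[of _ "prod q J"] conjI exI[of _ "\<lambda>j. fst (quotient_of (c j)) * prod q (J - {j})"]) auto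
qed

text \<open>The denominators of the coefficients are cleared by \<open>Q\<close>, those of the
  unknowns by \<open>D\<close>. Every rational solution is the image of an integer one under
  \<open>\<phi>\<close> applied coordinatewise.\<close>

lemma card_rational_solutions_le_integer_solutions:
  fixes c :: "'j \<Rightarrow> rat"
  assumes J: "finite J" and c: "\<And>j. j \<in> J \<Longrightarrow> c j \<noteq> 0"
    and N: "N = nat \<lfloor>H\<rfloor>" and D: "\<And>b. b \<in> {1..N} \<Longrightarrow> b dvd D"
  shows "\<exists>c' :: 'j \<Rightarrow> int. (\<forall>j\<in>J. c' j \<noteq> 0) \<and>
    card {x \<in> J \<rightarrow>\<^sub>E height_rats H. (\<Sum>j\<in>J. c j * x j) = 0}
    \<le> card {f \<in> J \<rightarrow>\<^sub>E {- int N..int N} \<times> {1..N}.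
      (\<Sum>j\<in>J. c' j * (fst (f j) * int (D div snd (f j)))) = 0}"
    (is "\<exists>c'. _ \<and> card ?X \<le> card (?Y c')")
proof -
  obtain Q and c' :: "'j \<Rightarrow> int"
    where Q: "Q > 0" "\<And>j. j \<in> J \<Longrightarrow> of_int (c' j) = of_int Q * c j"
    using common_denominator[OF J, of c] by blast
  have "c' j \<noteq> 0" if "j \<in> J" for j
    using Q(2)[OF that] Q(1) c[OF that] by auto
  define \<phi> where "\<phi> p = (of_int (fst p) / of_nat (snd p) :: rat)" for p :: "int \<times> nat"
  have "?X \<subseteq> (\<lambda>f. \<lambda>j\<in>J. \<phi> (f j)) ` ?Y c'"
  proof
    fix x assume x: "x \<in> ?X"
    have "\<forall>j\<in>J. \<exists>p\<in>{- int N..int N} \<times> {1..N}. x j = \<phi> p"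
      unfolding \<phi>_def using x height_rats_subset[OF _ N] by auto
    then obtain g where g: "\<And>j. j \<in> J \<Longrightarrow> g j \<in> {- int N..int N} \<times> {1..N}" "\<And>j. j \<in> J \<Longrightarrow> x j = \<phi> (g j)"
      by metis
    define f where "f = restrict g J"
    have f: "f \<in> J \<rightarrow>\<^sub>E {- int N..int N} \<times> {1..N}" "\<And>j. j \<in> J \<Longrightarrow> x j = \<phi> (f j)"
      using g by (auto simp: f_def)
    have "of_int (\<Sum>j\<in>J. c' j * (fst (f j) * int (D div snd (f j)))) = (\<Sum>j\<in>J. of_int Q * of_nat D * (c j * x j))"
      unfolding of_int_sum
    proof (rule sum.cong[OF refl])
      fix j assume j: "j \<in> J"
      have "snd (f j) \<in> {1..N}" using PiE_mem[OF f(1) j] by auto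
      moreover from this have "snd (f j) dvd D" by (rule D)
      then obtain t where "D = snd (f j) * t" by (elim dvdE)
      ultimately have "(of_nat (D div snd (f j)) :: rat) = of_nat D / of_nat (snd (f j))"
        by simp
      then show "of_int (c' j * (fst (f j) * int (D div snd (f j)))) = of_int Q * of_nat D * (c j * x j)"
        using Q(2)[OF j] f(2)[OF j] by (simp add: \<phi>_def)
    qed
    also have "\<dots> = 0" using x by (simp flip: sum_distrib_left)
    finally have "f \<in> ?Y c'" using f(1) by (simp only: mem_Collect_eq of_int_eq_0_iff) 
    moreover have "x = (\<lambda>j\<in>J. \<phi> (f j))"
      using x f(2) by (intro extensionalityI[of _ J]) (auto simp: PiE_def)
    ultimately show "x \<in> (\<lambda>f. \<lambda>j\<in>J. \<phi> (f j)) ` ?Y c'" by blast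
  qed
  moreover have "finite (?Y c')"
    by (rule finite_subset[OF _ finite_PiE[OF J, of "\<lambda>_. {- int N..int N} \<times> {1..N}"]]) auto
  ultimately have "card ?X \<le> card (?Y c')" by (intro surj_card_le)
  then show ?thesis using \<open>\<And>j. j \<in> J \<Longrightarrow> c' j \<noteq> 0\<close> by blast
qed

text \<open>The order of the quantifiers matters: \<open>C\<close> is uniform in \<open>c\<close>,
  because the coefficients will come from relations between columns that are themselves being
  counted.\<close>

lemma card_rational_solutions_le:
  fixes e :: real
  assumes "e > 0" "k > 0"
  shows "\<exists>C\<ge>1. \<forall>H\<ge>1. \<forall>J. \<forall>c :: 'j \<Rightarrow> rat. card J = k \<longrightarrow> (\<forall>j\<in>J. c j \<noteq> 0) \<longrightarrow>
    real (card {x \<in> J \<rightarrow>\<^sub>E height_rats H. (\<Sum>j\<in>J. c j * x j) = 0}) \<le> C * H powr (real k + e)"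
proof -
  \<comment> \<open>The \<open>k\<close> sums of weights lose the exponent
    \<open>k * e1 = e / 2\<close>; the divisor moment loses the other half.\<close>
  define e1 where "e1 = e / (2 * real k)"
  have e1: "e1 > 0" using assms by (simp add: e1_def)
  obtain C where C: "C \<ge> 1" "\<And>N D. N \<ge> 1 \<Longrightarrow>
      (\<Sum>n\<in>{1..D}. real (card {b\<in>{1..N}. b dvd n}) ^ k) \<le> C * real N powr (e / 2) * real D"
    using small_divisors_moment[of "e / 2" k] assms(1) by auto
  define K where "K = 3 * (3 * (1 + 1 / e1))"
  have K: "K \<ge> 1" using e1 by (simp add: K_def)
  have "real (card {x \<in> J \<rightarrow>\<^sub>E height_rats H. (\<Sum>j\<in>J. c j * x j) = 0}) \<le> 2 * real k * K ^ k * C * H powr (real k + e)"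
    if H: "H \<ge> 1" and J: "card J = k" and c: "\<forall>j\<in>J. c j \<noteq> 0" for H J and c :: "'j \<Rightarrow> rat"
  proof -
    define N where "N = nat \<lfloor>H\<rfloor>"
    have N: "N \<ge> 1" "real N \<le> H" using H unfolding N_def by linarith+
    \<comment> \<open>The size of this common multiple of \<open>1, ..., N\<close> is harmless: the
      moment bound is linear in \<open>D\<close> and gets divided by \<open>D\<close>.\<close>
    define D where "D = (fact N :: nat)"
    have D: "D > 0" "\<And>b. b \<in> {1..N} \<Longrightarrow> b dvd D" by (auto simp: D_def dvd_fact)
    have fJ: "finite J" "J \<noteq> {}" using J assms(2) card_gt_0_iff by fastforce+
    obtain c' :: "'j \<Rightarrow> int" where c': "\<And>j. j \<in> J \<Longrightarrow> c' j \<noteq> 0" and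
      le: "card {x \<in> J \<rightarrow>\<^sub>E height_rats H. (\<Sum>j\<in>J. c j * x j) = 0}
      \<le> card {f \<in> J \<rightarrow>\<^sub>E {- int N..int N} \<times> {1..N}. (\<Sum>j\<in>J. c' j * (fst (f j) * int (D div snd (f j)))) = 0}"
      using card_rational_solutions_le_integer_solutions[OF fJ(1) _ N_def D(2), of c] c by blast
    let ?W = "\<Sum>u\<in>{- int N..int N}. decay u"
    have W: "0 \<le> ?W" "?W \<le> 3 * (1 + 1 / e1) * real N powr e1"
      using sum_decay_le[OF e1 N(1)] by (auto intro: sum_nonneg decay_nonneg)
    have "real (card {x \<in> J \<rightarrow>\<^sub>E height_rats H. (\<Sum>j\<in>J. c j * x j) = 0})
      \<le> real (card {f \<in> J \<rightarrow>\<^sub>E {- int N..int N} \<times> {1..N}. (\<Sum>j\<in>J. c' j * (fst (f j) * int (D div snd (f j)))) = 0})"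
      using le by (simp only: of_nat_le_iff)
    also have "\<dots> \<le> 2 * real k * (3 * real N * ?W) ^ k * (\<Sum>n\<in>{1..D}. real (card {b\<in>{1..N}. b dvd n}) ^ k) / real D"
      using card_integer_solutions_le[OF fJ D c'] unfolding J .
    also have "\<dots> \<le> 2 * real k * (3 * real N * ?W) ^ k * (C * real N powr (e / 2) * real D) / real D"
      using W(1) C(2)[OF N(1)] by (intro divide_right_mono mult_left_mono) auto
    also have "\<dots> = 2 * real k * (3 * real N * ?W) ^ k * (C * real N powr (e / 2))"
      using D(1) by simp
    also have "\<dots> \<le> 2 * real k * (K * real N powr (1 + e1)) ^ k * (C * real N powr (e / 2))"
    proof -
      have "3 * real N * ?W \<le> 3 * real N * (3 * (1 + 1 / e1) * real N powr e1)"
        using W by (intro mult_left_mono) auto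
      also have "\<dots> = K * real N powr (1 + e1)" using N(1) by (simp add: K_def powr_add)
      finally have "(3 * real N * ?W) ^ k \<le> (K * real N powr (1 + e1)) ^ k"
        using W(1) by (intro power_mono) auto
      then show ?thesis using C(1) by (intro mult_right_mono mult_left_mono) auto
    qed
    also have "\<dots> = 2 * real k * K ^ k * C * (real N powr ((1 + e1) * real k) * real N powr (e / 2))"
      using N(1) by (simp add: power_mult_distrib powr_power mult.commute)
    also have "\<dots> = 2 * real k * K ^ k * C * real N powr (real k + e)"
    proof -
      have "(1 + e1) * real k + e / 2 = real k + e" using assms by (simp add: e1_def field_simps)
      then show ?thesis by (simp flip: powr_add)
    qed
    also have "\<dots> \<le> 2 * real k * K ^ k * C * H powr (real k + e)"
      using N K C(1) assms by (intro mult_left_mono powr_mono2) auto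
    finally show ?thesis .
  qed
  moreover have "1 * 1 * 1 \<le> 2 * real k * K ^ k * C"
    using K C(1) assms(2) by (intro mult_mono one_le_power) auto
  ultimately show ?thesis by (intro exI[of _ "2 * real k * K ^ k * C"]) auto
qed

section \<open>Counting matrices\<close>

text \<open>A matrix is a function \<open>A j i\<close> of the column \<open>j\<close> and then the
  row \<open>i\<close>. It splits into the columns in \<open>J\<close>, recorded as
  \<open>X\<close>, and the other columns, each of which is a grid point in the span of
  \<open>X\<close>.\<close>

lemma card_spanned_matrices_le_sum:
  fixes F :: "'a::field set" and R :: "'i set" and C :: "'q set"
  assumes fin: "finite R" "finite C" "finite F" and J: "J \<subseteq> C"
  shows "card {A \<in> C \<rightarrow>\<^sub>E (R \<rightarrow>\<^sub>E F). \<forall>j\<in>C. \<exists>d. \<forall>i\<in>R. A j i = (\<Sum>q\<in>J. d q * A q i)}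
    \<le> (\<Sum>X\<in>J \<rightarrow>\<^sub>E (R \<rightarrow>\<^sub>E F).
        card {x \<in> R \<rightarrow>\<^sub>E F. \<exists>d. \<forall>i\<in>R. x i = (\<Sum>q\<in>J. d q * X q i)} ^ card (C - J))"
    (is "card ?L \<le> (\<Sum>X\<in>?X. card (?T X) ^ _)")
proof -
  let ?S = "SIGMA X:?X. (C - J) \<rightarrow>\<^sub>E ?T X"
  have finT: "finite (?T X)" for X
    by (rule finite_subset[OF _ finite_PiE[OF fin(1), of "\<lambda>_. F"]]) (use fin in auto)
  have finJ: "finite J" using J fin(2) by (rule finite_subset)
  have fX: "finite ?X" using finJ fin by (intro finite_PiE)
  let ?g = "\<lambda>A. (restrict A J, restrict A (C - J))"
  have "inj_on ?g ?L"
  proof (rule inj_onI)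
    fix A B assume A: "A \<in> ?L" and B: "B \<in> ?L" and eq: "?g A = ?g B"
    have "A j = B j" if "j \<in> C" for j
    proof (cases "j \<in> J")
      case True
      then show ?thesis using eq by (metis Pair_inject restrict_apply')
    next
      case False
      then have "j \<in> C - J" using that by simp
      then show ?thesis using eq by (metis Pair_inject restrict_apply')
    qed
    then show "A = B" using A B by (intro PiE_ext[of A C _ B]) auto
  qed
  moreover have "?g ` ?L \<subseteq> ?S"
  proof
    fix y assume "y \<in> ?g ` ?L"
    then obtain A where A: "A \<in> C \<rightarrow>\<^sub>E (R \<rightarrow>\<^sub>E F)"
      "\<And>j. j \<in> C \<Longrightarrow> \<exists>d. \<forall>i\<in>R. A j i = (\<Sum>q\<in>J. d q * A q i)" "y = ?g A" by blast
    have "restrict A J \<in> ?X" using A(1) J by auto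
    moreover have "restrict A (C - J) \<in> (C - J) \<rightarrow>\<^sub>E ?T (restrict A J)"
      unfolding restrict_PiE_iff
    proof
      fix j assume j: "j \<in> C - J"
      then have "A j \<in> R \<rightarrow>\<^sub>E F" using A(1) by auto
      moreover obtain d where "\<forall>i\<in>R. A j i = (\<Sum>q\<in>J. d q * A q i)" using A(2) j by blast
      then have "\<forall>i\<in>R. A j i = (\<Sum>q\<in>J. d q * restrict A J q i)" by simp
      ultimately show "A j \<in> ?T (restrict A J)" by blast
    qed
    ultimately show "y \<in> ?S" using A(3) by simp
  qed
  moreover have "finite ?S"
    by (rule finite_SigmaI[OF fX], rule finite_PiE) (use fin finT in auto)
  ultimately have "card ?L \<le> card ?S" by (rule card_inj_on_le)
  also have "\<dots> = (\<Sum>X\<in>?X. card ((C - J) \<rightarrow>\<^sub>E ?T X))"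
    by (rule card_SigmaI[OF fX], rule ballI, rule finite_PiE) (use fin finT in auto)
  also have "\<dots> = (\<Sum>X\<in>?X. card (?T X) ^ card (C - J))"
    using fin by (simp add: card_PiE)
  finally show ?thesis .
qed

text \<open>The rows in \<open>I\<close> are free. Any other row \<open>i\<close>, read as a vector
  indexed by \<open>J\<close>, lies in the span of the rows in \<open>P i\<close>, so it has at most
  \<open>card F ^ card (P i)\<close> values over all choices of the coefficients.\<close>

lemma card_arrays_with_row_relations_le:
  fixes F :: "'a::field set" and R I :: "'i set" and J :: "'q set"
  assumes fin: "finite R" "finite J" "finite F" "F \<noteq> {}" and I: "I \<subseteq> R"
    and P: "\<And>i. i \<in> R - I \<Longrightarrow> P i \<subseteq> I"
  shows "card {X \<in> J \<rightarrow>\<^sub>E (R \<rightarrow>\<^sub>E F). \<exists>c. \<forall>i\<in>R - I. \<forall>q\<in>J. X q i = (\<Sum>l\<in>P i. c i l * X q l)}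
    \<le> card F ^ (card J * card I) * (\<Prod>i\<in>R - I. card F ^ card (P i))"
    (is "card ?X \<le> _")
proof -
  let ?Y = "I \<rightarrow>\<^sub>E (J \<rightarrow>\<^sub>E F)"
  let ?W = "\<lambda>Y i. {w \<in> J \<rightarrow>\<^sub>E F. \<exists>d. \<forall>q\<in>J. w q = (\<Sum>l\<in>P i. d l * Y l q)}"
  let ?S = "SIGMA Y:?Y. PiE (R - I) (?W Y)"
  let ?g = "\<lambda>X. (\<lambda>l\<in>I. \<lambda>q\<in>J. X q l, \<lambda>i\<in>R - I. \<lambda>q\<in>J. X q i)"
  have finI: "finite I" using I fin(1) by (rule finite_subset)
  have finP: "finite (P i)" if "i \<in> R - I" for i using P[OF that] finI by (rule finite_subset)
  have finY: "finite ?Y" using finI fin by (intro finite_PiE) auto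
  have finW: "finite (?W Y i)" for Y i
    by (rule finite_subset[OF _ finite_PiE[OF fin(2), of "\<lambda>_. F"]]) (use fin in auto)
  have "inj_on ?g ?X"
  proof (rule inj_onI)
    fix A B assume A: "A \<in> ?X" and B: "B \<in> ?X" and eq: "?g A = ?g B"
    have "A q i = B q i" if q: "q \<in> J" and i: "i \<in> R" for q i
    proof (cases "i \<in> I")
      case True
      have "(\<lambda>l\<in>I. \<lambda>q\<in>J. A q l) i q = (\<lambda>l\<in>I. \<lambda>q\<in>J. B q l) i q" using eq by (simp only: prod.inject)
      then show ?thesis using True q by simp
    next
      case False
      have "(\<lambda>l\<in>R-I. \<lambda>q\<in>J. A q l) i q = (\<lambda>l\<in>R-I. \<lambda>q\<in>J. B q l) i q" using eq by (simp only: prod.inject)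
      then show ?thesis using False i q by simp
    qed
    moreover have AB: "A q \<in> R \<rightarrow>\<^sub>E F" "B q \<in> R \<rightarrow>\<^sub>E F" if "q \<in> J" for q using A B that by auto
    ultimately have "A q = B q" if "q \<in> J" for q
      using that by (intro PiE_ext[OF AB])
    then show "A = B" using A B by (intro PiE_ext[of A J _ B]) auto
  qed
  moreover have "?g ` ?X \<subseteq> ?S"
  proof
    fix y assume "y \<in> ?g ` ?X"
    then obtain X c where X: "X \<in> J \<rightarrow>\<^sub>E (R \<rightarrow>\<^sub>E F)"
      "\<And>i q. i \<in> R - I \<Longrightarrow> q \<in> J \<Longrightarrow> X q i = (\<Sum>l\<in>P i. c i l * X q l)" "y = ?g X" by blast
    have XF: "X q i \<in> F" if "q \<in> J" "i \<in> R" for q i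
      using PiE_mem[OF X(1) that(1)] that(2) by auto
    have "(\<lambda>l\<in>I. \<lambda>q\<in>J. X q l) \<in> ?Y" using XF I by auto
    moreover have "(\<lambda>i\<in>R - I. \<lambda>q\<in>J. X q i) \<in> PiE (R - I) (?W (\<lambda>l\<in>I. \<lambda>q\<in>J. X q l))"
      unfolding restrict_PiE_iff
    proof
      fix i assume i: "i \<in> R - I"
      have "X q i = (\<Sum>l\<in>P i. c i l * (\<lambda>l\<in>I. \<lambda>q\<in>J. X q l) l q)" if "q \<in> J" for q
        using X(2)[OF i that] P[OF i] that by (simp add: subset_iff)
      then show "(\<lambda>q\<in>J. X q i) \<in> ?W (\<lambda>l\<in>I. \<lambda>q\<in>J. X q l) i"
        using XF i by (intro CollectI conjI exI[of _ "c i"]) auto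
    qed
    ultimately show "y \<in> ?S" using X(3) by simp
  qed
  moreover have "finite ?S"
    by (rule finite_SigmaI[OF finY], rule finite_PiE) (use fin finW in auto)
  ultimately have "card ?X \<le> card ?S" by (rule card_inj_on_le)
  also have "\<dots> = (\<Sum>Y\<in>?Y. card (PiE (R - I) (?W Y)))"
    by (rule card_SigmaI[OF finY], rule ballI, rule finite_PiE) (use fin finW in auto)
  also have "\<dots> = (\<Sum>Y\<in>?Y. \<Prod>i\<in>R - I. card (?W Y i))"
    using fin by (simp add: card_PiE)
  also have "\<dots> \<le> (\<Sum>Y\<in>?Y. \<Prod>i\<in>R - I. card F ^ card (P i))"
    using fin finP by (intro sum_mono prod_mono conjI card_grid_points_span_le) auto
  also have "\<dots> = card F ^ (card J * card I) * (\<Prod>i\<in>R - I. card F ^ card (P i))"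
    using finI fin by (simp add: card_PiE power_mult)
  finally show ?thesis .
qed

text \<open>The row relations of the spanning columns pass to their span, so the coordinates in
  \<open>I\<close> determine a point. Those outside \<open>P i0\<close> are bounded trivially; the
  others, together with \<open>i0\<close>, satisfy the relation of row \<open>i0\<close>, which the
  coefficient \<open>- 1\<close> puts into homogeneous form.\<close>

lemma card_span_points_le_relation_points:
  fixes F :: "'a::field set" and R I :: "'i set" and J :: "'q set" and X :: "'q \<Rightarrow> 'i \<Rightarrow> 'a"
  assumes fin: "finite R" "finite F" and I: "I \<subseteq> R"
    and P: "\<And>i. i \<in> R - I \<Longrightarrow> P i \<subseteq> I"
    and rel: "\<And>i q. i \<in> R - I \<Longrightarrow> q \<in> J \<Longrightarrow> X q i = (\<Sum>l\<in>P i. c i l * X q l)"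
    and i0: "i0 \<in> R - I"
  shows "card {x \<in> R \<rightarrow>\<^sub>E F. \<exists>d. \<forall>i\<in>R. x i = (\<Sum>q\<in>J. d q * X q i)}
    \<le> card F ^ (card I - card (P i0)) *
      card {y \<in> insert i0 (P i0) \<rightarrow>\<^sub>E F. (\<Sum>j\<in>insert i0 (P i0). (if j = i0 then - 1 else c i0 j) * y j) = 0}"
    (is "card ?T \<le> _ * card ?Y")
proof -
  let ?Z = "(I - P i0) \<rightarrow>\<^sub>E F"
  let ?g = "\<lambda>x. (restrict x (I - P i0), restrict x (insert i0 (P i0)))"
  have finI: "finite I" using I fin(1) by (rule finite_subset)
  have finP: "finite (P i0)" using P[OF i0] finI by (rule finite_subset)
  have dep: "x i = (\<Sum>l\<in>P i. c i l * x l)" if x: "x \<in> ?T" and i: "i \<in> R - I" for x i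
  proof -
    obtain d where d: "\<And>i. i \<in> R \<Longrightarrow> x i = (\<Sum>q\<in>J. d q * X q i)" using x by blast
    have "x i = (\<Sum>q\<in>J. d q * X q i)" using i by (intro d) auto
    also have "\<dots> = (\<Sum>q\<in>J. \<Sum>l\<in>P i. d q * (c i l * X q l))"
      using rel[OF i] by (simp add: sum_distrib_left)
    also have "\<dots> = (\<Sum>l\<in>P i. \<Sum>q\<in>J. d q * (c i l * X q l))" by (rule sum.swap)
    also have "\<dots> = (\<Sum>l\<in>P i. c i l * x l)"
      using P[OF i] I d by (intro sum.cong refl) (auto simp: sum_distrib_left mult_ac subset_iff)
    finally show ?thesis .
  qed
  have "inj_on ?g ?T"
  proof (rule inj_onI)
    fix x y assume x: "x \<in> ?T" and y: "y \<in> ?T" and eq: "?g x = ?g y"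
    have I': "x l = y l" if "l \<in> I" for l
    proof (cases "l \<in> P i0")
      case True
      then show ?thesis using eq by (metis Pair_inject restrict_apply' insertI2)
    next
      case False
      then have "l \<in> I - P i0" using that by simp
      then show ?thesis using eq by (metis Pair_inject restrict_apply')
    qed
    have "x i = y i" if "i \<in> R" for i
    proof (cases "i \<in> I")
      case False
      then have i: "i \<in> R - I" using that by simp
      show ?thesis unfolding dep[OF x i] dep[OF y i]
        using P[OF i] I' by (intro sum.cong) auto
    qed (rule I')
    then show "x = y" using x y by (intro PiE_ext[of x R _ y]) auto
  qed
  moreover have "?g ` ?T \<subseteq> ?Z \<times> ?Y"
  proof
    fix z assume "z \<in> ?g ` ?T"
    then obtain x where x: "x \<in> ?T" "z = ?g x" by blast
    have "restrict x (I - P i0) \<in> ?Z" using x I by auto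
    moreover have "restrict x (insert i0 (P i0)) \<in> ?Y"
    proof (intro CollectI conjI)
      show "restrict x (insert i0 (P i0)) \<in> insert i0 (P i0) \<rightarrow>\<^sub>E F"
        using x P[OF i0] I i0 by auto
      have "i0 \<notin> P i0" using P[OF i0] i0 by auto
      then have "(\<Sum>j\<in>insert i0 (P i0). (if j = i0 then - 1 else c i0 j) * restrict x (insert i0 (P i0)) j)
          = - x i0 + (\<Sum>j\<in>P i0. c i0 j * x j)"
        using finP by (simp, intro sum.cong) auto
      then show "(\<Sum>j\<in>insert i0 (P i0). (if j = i0 then - 1 else c i0 j) * restrict x (insert i0 (P i0)) j) = 0"
        using dep[OF x(1) i0] by simp
    qed
    ultimately show "z \<in> ?Z \<times> ?Y" using x(2) by simp
  qed
  moreover have "finite (?Z \<times> ?Y)"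
    using finI fin finP
    by (intro finite_cartesian_product finite_subset[OF _ finite_PiE[of "insert i0 (P i0)" "\<lambda>_. F"]] finite_PiE) auto
  ultimately have "card ?T \<le> card (?Z \<times> ?Y)" by (rule card_inj_on_le)
  also have "\<dots> = card F ^ (card I - card (P i0)) * card ?Y"
    using finI P[OF i0] finP by (simp add: card_cartesian_product card_PiE card_Diff_subset)
  finally show ?thesis .
qed

text \<open>\<open>P i\<close> is the support of the relation for row \<open>i\<close>. Taking
  \<open>P\<close> extensional leaves only finitely many pairs \<open>(I, P)\<close>, by which the
  arrays can be sorted.\<close>

lemma exists_row_relations:
  fixes X :: "'q \<Rightarrow> 'i \<Rightarrow> 'a::field"
  assumes "finite R" "finite J" "card J \<le> card R"
  shows "\<exists>I P c. I \<subseteq> R \<and> card I = card J \<and> P \<in> (R - I) \<rightarrow>\<^sub>E Pow I \<and>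
    (\<forall>i\<in>R - I. \<forall>l\<in>P i. c i l \<noteq> 0) \<and>
    (\<forall>i\<in>R - I. \<forall>q\<in>J. X q i = (\<Sum>l\<in>P i. c i l * X q l))"
proof -
  obtain I c where I: "I \<subseteq> R" "card I = card J"
    and c: "\<And>q i. q \<in> J \<Longrightarrow> i \<in> R \<Longrightarrow> X q i = (\<Sum>l\<in>I. c i l * X q l)"
    using coordinate_dependence_card_eq[OF assms(2,1,3), of X] by blast
  define P where "P = (\<lambda>i\<in>R - I. {l\<in>I. c i l \<noteq> 0})"
  have "finite I" using I(1) assms(1) by (rule finite_subset)
  then have "X q i = (\<Sum>l\<in>P i. c i l * X q l)" if "i \<in> R - I" "q \<in> J" for i q
    using c[of q i] that unfolding P_def
    by (simp, intro sum.mono_neutral_right) auto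
  moreover have "P \<in> (R - I) \<rightarrow>\<^sub>E Pow I" by (auto simp: P_def)
  moreover have "\<forall>i\<in>R - I. \<forall>l\<in>P i. c i l \<noteq> 0" by (auto simp: P_def)
  ultimately show ?thesis using I by (intro exI[of _ I] exI[of _ P] exI[of _ c]) blast
qed

text \<open>The arrays of spanning columns are sorted by their pair \<open>(I, P)\<close>; the
  number of pairs does not depend on \<open>H\<close>. For a pair with largest support size
  \<open>t\<close>, the hypotheses on \<open>E\<close> say that it dominates the total exponent,
  separately for \<open>t = 0\<close> and for \<open>t \<ge> 1\<close>.\<close>

lemma card_spanned_matrices_le:
  fixes R :: "'i set" and C J :: "'q set" and e E :: real
  assumes fin: "finite R" "finite C" and J: "J \<subseteq> C" "card J = r" and r: "r < card R" and e: "e > 0"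
    and E0: "2 * real (r * r) + 2 * real r * real (card C - r) \<le> E"
    and E: "\<And>t. 1 \<le> t \<Longrightarrow> t \<le> r \<Longrightarrow>
      2 * real (r * r + t * (card R - r)) + (2 * real r - real t + 1) * real (card C - r) \<le> E"
  shows "\<exists>K. \<forall>H\<ge>1. real (card {A \<in> C \<rightarrow>\<^sub>E (R \<rightarrow>\<^sub>E height_rats H).
      \<forall>j\<in>C. \<exists>d. \<forall>i\<in>R. A j i = (\<Sum>q\<in>J. d q * A q i)}) \<le> K * H powr (E + e * real (card C - r))"
proof -
  define s where "s = card C - r"
  define w where "w = card R - r"
  let ?Q = "\<lambda>k B. \<forall>H\<ge>1. \<forall>J. \<forall>c :: 'i \<Rightarrow> rat. card J = k \<longrightarrow> (\<forall>j\<in>J. c j \<noteq> 0) \<longrightarrow>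
    real (card {x \<in> J \<rightarrow>\<^sub>E height_rats H. (\<Sum>j\<in>J. c j * x j) = 0}) \<le> B * H powr (real k + e)"
  \<comment> \<open>One constant for each length \<open>k\<close> of the equation;
    \<open>k = 0\<close>, outside the range of the counting bound, gets the dummy value 1.\<close>
  have "\<exists>B. B \<ge> 1 \<and> (k > 0 \<longrightarrow> ?Q k B)" for k
  proof (cases "k > 0")
    case True
    obtain B where "B \<ge> 1" "?Q k B" using card_rational_solutions_le[OF e True, where 'j = 'i] by (elim exE conjE)
    then show ?thesis by (intro exI[of _ B] conjI impI)
  next
    case False
    then show ?thesis by (intro exI[of _ 1]) simp
  qed
  then have "\<exists>B. \<forall>k. B k \<ge> 1 \<and> (k > 0 \<longrightarrow> ?Q k (B k))" by (intro choice allI)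
  then obtain B where BQ: "\<forall>k. B k \<ge> 1 \<and> (k > 0 \<longrightarrow> ?Q k (B k))" ..
  have B1: "B k \<ge> 1" for k using BQ by simp
  have B: "real (card {x \<in> J \<rightarrow>\<^sub>E height_rats H. (\<Sum>j\<in>J. c j * x j) = 0}) \<le> B k * H powr (real k + e)"
    if "k > 0" "H \<ge> 1" "card J = k" "\<forall>j\<in>J. c j \<noteq> 0" for k H J and c :: "'i \<Rightarrow> rat"
    using spec[OF BQ, of k] that by simp
  \<comment> \<open>Only the lengths \<open>t + 1 \<le> r + 1\<close> occur, and \<open>b\<close>
    majorises all their constants.\<close>
  define b where "b = (\<Sum>k\<le>r + 1. B k)"
  have b: "B k \<le> b" if "k \<le> r + 1" for k
    unfolding b_def using that B1 by (intro member_le_sum) (auto intro: order_trans[OF zero_le_one])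
  have b1: "1 \<le> b" using b[of 0] B1[of 0] by simp
  \<comment> \<open>\<open>K1\<close> is the constant for one remaining column, \<open>K2\<close>
    for one fibre of arrays. The powers of 3 come from
    \<open>card F \<le> 3 * H powr 2\<close>.\<close>
  define K1 where "K1 = 3 ^ r * b"
  define K2 where "K2 = 3 ^ (r * r + r * w) * K1 ^ s"
  have "(1::real) * 1 \<le> 3 ^ r * b" using b1 by (intro mult_mono) auto
  then have K1: "1 \<le> K1" by (simp add: K1_def)
  define Idx where "Idx = (SIGMA I:{I. I \<subseteq> R \<and> card I = r}. (R - I) \<rightarrow>\<^sub>E Pow I)"
  have finIdx: "finite Idx"
    unfolding Idx_def using fin(1) by (intro finite_SigmaI finite_PiE) (auto intro: finite_subset)
  have finJ: "finite J" using J(1) fin(2) by (rule finite_subset)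
  have "real (card {A \<in> C \<rightarrow>\<^sub>E (R \<rightarrow>\<^sub>E height_rats H).
      \<forall>j\<in>C. \<exists>d. \<forall>i\<in>R. A j i = (\<Sum>q\<in>J. d q * A q i)})
      \<le> real (card Idx) * K2 * H powr (E + e * real s)" if H: "H \<ge> 1" for H
  proof -
    define F where "F = height_rats H"
    have F: "finite F" "F \<noteq> {}" unfolding F_def using finite_height_rats zero_in_height_rats[OF H] by auto
    have f: "1 \<le> real (card F)" "real (card F) \<le> 3 * H powr 2"
      using F card_height_rats_le[OF H] by (auto simp: F_def Suc_le_eq card_gt_0_iff)
    let ?X = "J \<rightarrow>\<^sub>E (R \<rightarrow>\<^sub>E F)"
    let ?T = "\<lambda>X. {x \<in> R \<rightarrow>\<^sub>E F. \<exists>d. \<forall>i\<in>R. x i = (\<Sum>q\<in>J. d q * X q i)}"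
    let ?rel = "\<lambda>X I P c. (\<forall>i\<in>R - I. \<forall>l\<in>P i. c i l \<noteq> 0) \<and>
      (\<forall>i\<in>R - I. \<forall>q\<in>J. X q i = (\<Sum>l\<in>P i. c i l * X q l))"
    have finX: "finite ?X" using finJ fin(1) F(1) by (intro finite_PiE) auto
    have "\<exists>p\<in>Idx. \<exists>c. ?rel X (fst p) (snd p) c" for X :: "'q \<Rightarrow> 'i \<Rightarrow> rat"
    proof -
      obtain I P c where "I \<subseteq> R \<and> card I = card J \<and> P \<in> (R - I) \<rightarrow>\<^sub>E Pow I \<and> ?rel X I P c"
        using exists_row_relations[OF fin(1) finJ, of X] J(2) r by auto
      then show ?thesis unfolding Idx_def using J(2) by (intro bexI[of _ "(I, P)"] exI[of _ c]) auto
    qed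
    \<comment> \<open>Choosing one pair for each \<open>X\<close> splits the arrays into disjoint
      fibres.\<close>
    then obtain \<iota> where \<iota>: "\<And>X :: 'q \<Rightarrow> 'i \<Rightarrow> rat. \<iota> X \<in> Idx" "\<And>X. \<exists>c. ?rel X (fst (\<iota> X)) (snd (\<iota> X)) c"
      by metis
    have fibre: "(\<Sum>X\<in>{X\<in>?X. \<iota> X = p}. real (card (?T X)) ^ s) \<le> K2 * H powr (E + e * real s)" if p: "p \<in> Idx" for p
    proof -
      obtain I P where IP: "p = (I, P)" "I \<subseteq> R" "card I = r" "P \<in> (R - I) \<rightarrow>\<^sub>E Pow I"
        using p by (auto simp: Idx_def)
      have P: "P i \<subseteq> I" if "i \<in> R - I" for i using IP(4) that by auto
      have finI: "finite I" using IP(2) fin(1) by (rule finite_subset)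
      have cRI: "card (R - I) = w" using IP(2,3) finI by (simp add: card_Diff_subset w_def)
      \<comment> \<open>Some row lies outside \<open>I\<close>, so the maximum defining
        \<open>t\<close> is over a nonempty set.\<close>
      moreover have "w > 0" using r by (simp add: w_def)
      ultimately have "R - I \<noteq> {}" by (metis card.empty less_irrefl)
      then have im: "finite ((\<lambda>i. card (P i)) ` (R - I))" "(\<lambda>i. card (P i)) ` (R - I) \<noteq> {}" using fin(1) by auto
      define t where "t = Max ((\<lambda>i. card (P i)) ` (R - I))"
      have t: "card (P i) \<le> t" if "i \<in> R - I" for i unfolding t_def using im that by (intro Max_ge) auto
      \<comment> \<open>Row \<open>i0\<close> has the longest relation. Its length bounds all
        supports when \<open>X\<close> is counted, and its equation restricts the remaining
        columns.\<close>
      obtain i0 where i0: "i0 \<in> R - I" "card (P i0) = t" using Max_in[OF im] unfolding t_def by auto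
      have tr: "t \<le> r" using i0 card_mono[OF finI P[OF i0(1)]] IP(3) by simp
      have finP: "finite (P i0)" using P[OF i0(1)] finI by (rule finite_subset)
      let ?S = "{X\<in>?X. \<iota> X = p}"
      have "?S \<subseteq> {X \<in> ?X. \<exists>c. \<forall>i\<in>R - I. \<forall>q\<in>J. X q i = (\<Sum>l\<in>P i. c i l * X q l)}"
      proof
        fix X assume X: "X \<in> ?S"
        obtain c where "?rel X (fst (\<iota> X)) (snd (\<iota> X)) c" using \<iota>(2)[of X] ..
        then show "X \<in> {X \<in> ?X. \<exists>c. \<forall>i\<in>R - I. \<forall>q\<in>J. X q i = (\<Sum>l\<in>P i. c i l * X q l)}"
          using X IP(1) by auto
      qed
      then have "card ?S \<le> card {X \<in> ?X. \<exists>c. \<forall>i\<in>R - I. \<forall>q\<in>J. X q i = (\<Sum>l\<in>P i. c i l * X q l)}"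
        using finX by (intro card_mono) auto
      also have "\<dots> \<le> card F ^ (card J * card I) * (\<Prod>i\<in>R - I. card F ^ card (P i))"
        by (rule card_arrays_with_row_relations_le[OF fin(1) finJ F IP(2) P])
      also have "\<dots> \<le> card F ^ (card J * card I) * (\<Prod>i\<in>R - I. card F ^ t)"
        using t f(1) by (intro mult_left_mono prod_mono conjI power_increasing) auto
      also have "\<dots> = card F ^ (r * r + t * w)"
        by (simp add: J(2) IP(3) cRI power_add power_mult)
      finally have "real (card ?S) \<le> real (card F ^ (r * r + t * w))" by (simp only: of_nat_le_iff)
      also have "\<dots> \<le> (3 * H powr 2) ^ (r * r + t * w)"
        unfolding of_nat_power using f by (intro power_mono) auto
      also have "\<dots> = 3 ^ (r * r + t * w) * H powr (2 * real (r * r + t * w))"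
        using H by (simp only: power_mult_distrib powr_power mult.commute)
      also have "\<dots> \<le> 3 ^ (r * r + r * w) * H powr (2 * real (r * r + t * w))"
        using tr by (intro mult_right_mono power_increasing) auto
      finally have cS: "real (card ?S) \<le> 3 ^ (r * r + r * w) * H powr (2 * real (r * r + t * w))" .
      \<comment> \<open>For \<open>t \<ge> 1\<close> the free coordinates give
        \<open>2 * (r - t)\<close> and the equation in \<open>t + 1\<close> unknowns gives
        \<open>t + 1\<close>. At \<open>t = 0\<close> this would be \<open>2 * r + 1\<close>, so the
        trivial exponent \<open>2 * r\<close> replaces it.\<close>
      define \<beta> where "\<beta> = (if t = 0 then 2 * real r else 2 * real r - real t + 1)"
      have T: "real (card (?T X)) \<le> K1 * H powr (\<beta> + e)" if X: "X \<in> ?S" for X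
      proof (cases "t = 0")
        case True
        have "card (?T X) \<le> card F ^ card J" by (rule card_grid_points_span_le[OF finJ fin(1) F])
        then have "real (card (?T X)) \<le> real (card F ^ card J)" by (simp only: of_nat_le_iff)
        also have "\<dots> \<le> (3 * H powr 2) ^ r" unfolding of_nat_power J(2) using f by (intro power_mono) auto
        also have "\<dots> = 3 ^ r * H powr (2 * real r)"
          using H by (simp only: power_mult_distrib powr_power mult.commute)
        also have "\<dots> = 3 ^ r * 1 * H powr (2 * real r)" by simp
        also have "\<dots> \<le> 3 ^ r * b * H powr (\<beta> + e)"
          using H b1 e True by (intro mult_mono powr_mono) (auto simp: \<beta>_def)
        finally show ?thesis by (simp add: K1_def)
      next
        case False
        obtain c where c: "?rel X I P c" using \<iota>(2)[of X] X IP(1) by auto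
        let ?Y = "{y \<in> insert i0 (P i0) \<rightarrow>\<^sub>E F. (\<Sum>j\<in>insert i0 (P i0). (if j = i0 then - 1 else c i0 j) * y j) = 0}"
        have "card (?T X) \<le> card F ^ (card I - card (P i0)) * card ?Y"
          using c i0(1) by (intro card_span_points_le_relation_points fin F IP(2) P) auto
        then have "real (card (?T X)) \<le> real (card F ^ (r - t) * card ?Y)"
          unfolding IP(3) i0(2) by (simp only: of_nat_le_iff)
        also have "\<dots> = real (card F) ^ (r - t) * real (card ?Y)" by simp
        also have "\<dots> \<le> (3 * H powr 2) ^ (r - t) * (b * H powr (real (t + 1) + e))"
        proof (intro mult_mono power_mono)
          have "i0 \<notin> P i0" using P i0 by auto
          then have k: "card (insert i0 (P i0)) = t + 1" using finP i0(2) by simp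
          have "real (card ?Y) \<le> B (t + 1) * H powr (real (t + 1) + e)"
            unfolding F_def using c i0(1) by (intro B H k) auto
          also have "\<dots> \<le> b * H powr (real (t + 1) + e)"
            using tr by (intro mult_right_mono b) auto
          finally show "real (card ?Y) \<le> b * H powr (real (t + 1) + e)" .
        qed (use f in auto)
        also have "\<dots> = 3 ^ (r - t) * b * H powr (\<beta> + e)"
        proof -
          have "(3 * H powr 2) ^ (r - t) = 3 ^ (r - t) * H powr (2 * real (r - t))"
            using H by (simp only: power_mult_distrib powr_power mult.commute)
          moreover have "2 * real (r - t) + (real (t + 1) + e) = \<beta> + e"
            using tr False by (simp add: \<beta>_def of_nat_diff)
          then have "H powr (2 * real (r - t)) * H powr (real (t + 1) + e) = H powr (\<beta> + e)"
            by (simp only: powr_add[symmetric])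
          ultimately show ?thesis by (simp only: mult.assoc mult.left_commute)
        qed
        also have "\<dots> \<le> K1 * H powr (\<beta> + e)"
          unfolding K1_def using b1 by (intro mult_right_mono power_increasing) auto
        finally show ?thesis .
      qed
      have "(\<Sum>X\<in>?S. real (card (?T X)) ^ s) \<le> (\<Sum>X\<in>?S. (K1 * H powr (\<beta> + e)) ^ s)"
        using T by (intro sum_mono power_mono) auto
      also have "\<dots> = real (card ?S) * (K1 * H powr (\<beta> + e)) ^ s" by simp
      also have "\<dots> \<le> (3 ^ (r * r + r * w) * H powr (2 * real (r * r + t * w))) * (K1 * H powr (\<beta> + e)) ^ s"
        using cS K1 by (intro mult_right_mono) auto
      also have "(K1 * H powr (\<beta> + e)) ^ s = K1 ^ s * H powr ((\<beta> + e) * real s)"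
        using H by (simp only: power_mult_distrib powr_power mult.commute)
      also have "3 ^ (r * r + r * w) * H powr (2 * real (r * r + t * w)) * (K1 ^ s * H powr ((\<beta> + e) * real s))
          = K2 * H powr (2 * real (r * r + t * w) + (\<beta> + e) * real s)"
        by (simp add: K2_def powr_add)
      also have "\<dots> \<le> K2 * H powr (E + e * real s)"
      proof (intro mult_left_mono powr_mono)
        have "2 * real (r * r + t * w) + \<beta> * real s \<le> E"
          using E0 E[of t] tr unfolding \<beta>_def s_def w_def by (cases "t = 0") auto
        then show "2 * real (r * r + t * w) + (\<beta> + e) * real s \<le> E + e * real s"
          by (simp add: distrib_right)
      qed (use H K1 in \<open>auto simp: K2_def\<close>)
      finally show ?thesis .
    qed
    have cCJ: "card (C - J) = s" using J finJ by (simp add: card_Diff_subset s_def)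
    have "real (card {A \<in> C \<rightarrow>\<^sub>E (R \<rightarrow>\<^sub>E F). \<forall>j\<in>C. \<exists>d. \<forall>i\<in>R. A j i = (\<Sum>q\<in>J. d q * A q i)})
        \<le> real (\<Sum>X\<in>?X. card (?T X) ^ card (C - J))"
      using card_spanned_matrices_le_sum[OF fin F(1) J(1)] by (simp only: of_nat_le_iff)
    also have "\<dots> = (\<Sum>X\<in>?X. real (card (?T X)) ^ s)" by (simp add: cCJ)
    also have "\<dots> = (\<Sum>p\<in>Idx. \<Sum>X\<in>{X\<in>?X. \<iota> X = p}. real (card (?T X)) ^ s)"
      using finX finIdx \<iota>(1) by (intro sum.group[symmetric]) auto
    also have "\<dots> \<le> (\<Sum>p\<in>Idx. K2 * H powr (E + e * real s))"
      by (intro sum_mono fibre)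
    finally show ?thesis by (simp add: F_def mult.assoc)
  qed
  then show ?thesis unfolding s_def by blast
qed

text \<open>For \<open>t \<ge> 1\<close> the exponent is linear in \<open>t\<close> with slope
  \<open>2 * a - s\<close>, which is \<open>2 * m - n - r\<close>. The case distinction in
  \<open>E\<close> is the sign of this slope: the maximum is at \<open>t = r\<close> or at
  \<open>t = 1\<close>, and \<open>E\<close> is its value there. The exponent for
  \<open>t = 0\<close> is compared directly.\<close>

lemma height_mats_rank_bound_exponents:
  fixes m n r t :: nat
  assumes "n \<ge> m" "m > r"
  defines "E \<equiv> (if 2 * m \<ge> n + r
     then 2 * real m * real r + real n * real r + real n - (real r)^2 - real r
     else 2 * real n * real r + 2 * real m - 2 * real r)"
  shows "2 * real (r * r) + 2 * real r * real (n - r) \<le> E"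
    and "1 \<le> t \<Longrightarrow> t \<le> r \<Longrightarrow> 2 * real (r * r + t * (m - r)) + (2 * real r - real t + 1) * real (n - r) \<le> E"
proof -
  define a where "a = real m - real r"
  define s where "s = real n - real r"
  have as: "real (m - r) = a" "real (n - r) = s" "real m = a + real r" "real n = s + real r" "1 \<le> a" "a \<le> s"
    using assms(1,2) by (auto simp: a_def s_def)
  have cond: "2 * m \<ge> n + r \<longleftrightarrow> 2 * a \<ge> s"
  proof -
    have "2 * m \<ge> n + r \<longleftrightarrow> real (n + r) \<le> real (2 * m)" by (simp only: of_nat_le_iff)
    then show ?thesis unfolding a_def s_def by auto
  qed
  have E: "E = (if 2 * a \<ge> s then 2 * real r * real r + 2 * a * real r + s * real r + s
      else 2 * real r * real r + 2 * s * real r + 2 * a)"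
    unfolding E_def cond as(3,4) by (simp add: power2_eq_square algebra_simps)
  have main: "2 * real (r * r + t * (m - r)) + (2 * real r - real t + 1) * real (n - r)
      = 2 * real r * real r + 2 * s * real r + s + real t * (2 * a - s)" for t
    unfolding of_nat_add of_nat_mult as(1,2) by (simp add: algebra_simps)
  show "2 * real (r * r + t * (m - r)) + (2 * real r - real t + 1) * real (n - r) \<le> E"
    if t: "1 \<le> t" "t \<le> r" for t
  proof (cases "2 * a \<ge> s")
    case True
    then have "real t * (2 * a - s) \<le> real r * (2 * a - s)" using t by (intro mult_right_mono) auto
    then show ?thesis unfolding main E using True by (simp add: algebra_simps)
  next
    case False
    then have "real t * (2 * a - s) \<le> 1 * (2 * a - s)" using t by (intro mult_right_mono_neg) auto
    then show ?thesis unfolding main E if_not_P[OF False]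
      by (rule order_trans[OF add_left_mono]) simp
  qed
  show "2 * real (r * r) + 2 * real r * real (n - r) \<le> E"
  proof (cases "2 * a \<ge> s")
    case True
    then have "real r * s \<le> real r * (2 * a)" by (intro mult_left_mono) auto
    then show ?thesis unfolding E as(2) using True as(5,6) by (simp add: algebra_simps)
  next
    case False
    then show ?thesis unfolding E as(2) using as(5) by (simp add: algebra_simps)
  qed
qed

theorem theorem2p1:
  fixes m n r :: nat
  assumes "n \<ge> m" and "m > r"
  shows "powr_o1_bound (\<lambda>H. real (card (height_mats_rank m n r H)))
    (if 2 * m \<ge> n + r
     then 2 * real m * real r + real n * real r + real n - (real r)^2 - real r
     else 2 * real n * real r + 2 * real m - 2 * real r)"
    (is "powr_o1_bound _ ?E")
  unfolding powr_o1_bound_def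
proof (intro allI impI)
  fix \<epsilon> :: real
  assume eps: "\<epsilon> > 0"
  \<comment> \<open>Half of \<open>\<epsilon>\<close> covers the loss \<open>e\<close> in each of
    the \<open>n - r\<close> remaining columns; the other half will absorb the constant.\<close>
  define e where "e = \<epsilon> / (2 * (real (n - r) + 1))"
  have e: "e > 0" using eps by (simp add: e_def)
  have "e * real (n - r) \<le> e * (real (n - r) + 1)" using e by (intro mult_left_mono) auto
  also have "\<dots> = \<epsilon> / 2" by (simp add: e_def field_simps)
  finally have e2: "e * real (n - r) \<le> \<epsilon> / 2" .
  \<comment> \<open>\<open>L J H\<close> collects the matrices whose columns in \<open>J\<close>
    span all columns. Those of rank \<open>r\<close> are covered by the sets with
    \<open>card J = r\<close>, possibly several times.\<close>
  define L where "L J H = {A \<in> {..<n} \<rightarrow>\<^sub>E ({..<m} \<rightarrow>\<^sub>E height_rats H).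
      \<forall>j\<in>{..<n}. \<exists>d. \<forall>i\<in>{..<m}. A j i = (\<Sum>q\<in>J. d q * A q i)}" for J :: "nat set" and H
  define \<J> where "\<J> = {J. J \<subseteq> {..<n} \<and> card J = r}"
  have finJ: "finite \<J>" by (rule finite_subset[of _ "Pow {..<n}"]) (auto simp: \<J>_def)
  have finL: "finite (L J H)" for J H
    by (rule finite_subset[OF _ finite_PiE[of "{..<n}" "\<lambda>_. {..<m} \<rightarrow>\<^sub>E height_rats H"]])
       (auto simp: L_def intro!: finite_PiE finite_height_rats)
  have "\<forall>J\<in>\<J>. \<exists>K. \<forall>H\<ge>1. real (card (L J H)) \<le> K * H powr (?E + e * real (n - r))"
  proof
    fix J assume "J \<in> \<J>"
    then show "\<exists>K. \<forall>H\<ge>1. real (card (L J H)) \<le> K * H powr (?E + e * real (n - r))"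
      using card_spanned_matrices_le[of "{..<m}" "{..<n}" J r e ?E] assms e
        height_mats_rank_bound_exponents[OF assms]
      unfolding L_def \<J>_def by simp
  qed
  then obtain K where K: "\<And>J H. J \<in> \<J> \<Longrightarrow> H \<ge> 1 \<Longrightarrow> real (card (L J H)) \<le> K J * H powr (?E + e * real (n - r))"
    by metis
  have le: "real (card (height_mats_rank m n r H)) \<le> sum K \<J> * H powr (?E + e * real (n - r))" if H: "H \<ge> 1" for H
  proof -
    let ?g = "\<lambda>A :: rat mat. \<lambda>j\<in>{..<n}. \<lambda>i\<in>{..<m}. A $$ (i, j)"
    have "inj_on ?g (height_mats_rank m n r H)"
    proof (rule inj_onI)
      fix A B assume A: "A \<in> height_mats_rank m n r H" and B: "B \<in> height_mats_rank m n r H"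
        and eq: "?g A = ?g B"
      have "A $$ (i, j) = B $$ (i, j)" if "i < m" "j < n" for i j
        using fun_cong[OF fun_cong[OF eq, of j], of i] that by simp
      then show "A = B" using A B by (intro eq_matI) (auto simp: height_mats_rank_def height_mats_def)
    qed
    moreover have "?g ` height_mats_rank m n r H \<subseteq> (\<Union>J\<in>\<J>. L J H)"
    proof
      fix f assume "f \<in> ?g ` height_mats_rank m n r H"
      then obtain A where A: "A \<in> carrier_mat m n" "\<And>i j. i < m \<Longrightarrow> j < n \<Longrightarrow> A $$ (i, j) \<in> height_rats H"
        "vec_space.rank m A = r" "f = ?g A"
        by (auto simp: height_mats_rank_def height_mats_def)
      obtain J where J: "J \<subseteq> {..<n}" "card J = r"
        "\<And>j. j < n \<Longrightarrow> \<exists>d. \<forall>i<m. A $$ (i, j) = (\<Sum>q\<in>J. d q * A $$ (i, q))"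
        using vec_space.columns_spanned_by_rank_columns[OF A(1)] A(3) by auto
      have "f \<in> L J H"
        unfolding L_def
      proof (intro CollectI conjI ballI)
        show "f \<in> {..<n} \<rightarrow>\<^sub>E ({..<m} \<rightarrow>\<^sub>E height_rats H)" using A by auto
        fix j assume j: "j \<in> {..<n}"
        then obtain d where d: "\<forall>i<m. A $$ (i, j) = (\<Sum>q\<in>J. d q * A $$ (i, q))" using J(3) by auto
        have "f j i = (\<Sum>q\<in>J. d q * f q i)" if i: "i \<in> {..<m}" for i
        proof -
          have "(\<Sum>q\<in>J. d q * f q i) = (\<Sum>q\<in>J. d q * A $$ (i, q))"
            using J(1) i by (intro sum.cong) (auto simp: A(4))
          then show ?thesis using d i j by (simp add: A(4))
        qed
        then show "\<exists>d. \<forall>i\<in>{..<m}. f j i = (\<Sum>q\<in>J. d q * f q i)" by blast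
      qed
      then show "f \<in> (\<Union>J\<in>\<J>. L J H)" using J(1,2) by (auto simp: \<J>_def)
    qed
    ultimately have "card (height_mats_rank m n r H) \<le> card (\<Union>J\<in>\<J>. L J H)"
      using finJ finL by (intro card_inj_on_le) auto
    also have "\<dots> \<le> (\<Sum>J\<in>\<J>. card (L J H))" using finJ by (rule card_UN_le)
    finally have "real (card (height_mats_rank m n r H)) \<le> real (\<Sum>J\<in>\<J>. card (L J H))"
      by (simp only: of_nat_le_iff)
    also have "\<dots> = (\<Sum>J\<in>\<J>. real (card (L J H)))" by simp
    also have "\<dots> \<le> (\<Sum>J\<in>\<J>. K J * H powr (?E + e * real (n - r)))"
      using K H by (intro sum_mono) auto
    finally show ?thesis by (simp only: sum_distrib_right)
  qed
  have "filterlim (\<lambda>H::real. H powr (\<epsilon> / 2)) at_top at_top"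
    using eps by real_asymp
  then have "eventually (\<lambda>H. sum K \<J> \<le> H powr (\<epsilon> / 2)) at_top"
    by (simp only: filterlim_at_top)
  moreover have "eventually (\<lambda>H::real. H \<ge> 1) at_top" by (rule eventually_ge_at_top)
  ultimately show "eventually (\<lambda>H. real (card (height_mats_rank m n r H)) \<le> H powr (?E + \<epsilon>)) at_top"
  proof eventually_elim
    case (elim H)
    have "real (card (height_mats_rank m n r H)) \<le> sum K \<J> * H powr (?E + e * real (n - r))"
      using le elim by simp
    also have "\<dots> \<le> H powr (\<epsilon> / 2) * H powr (?E + e * real (n - r))"
      using elim by (intro mult_right_mono) auto
    also have "\<dots> = H powr (\<epsilon> / 2 + (?E + e * real (n - r)))" by (simp only: powr_add)
    also have "\<dots> \<le> H powr (?E + \<epsilon>)"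
      using elim e2 by (intro powr_mono) auto
    finally show ?case .
  qed
qed

end
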